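(* Let $$L_j=A_{j,0}+\sum_{i=1}^nX_iA_{j,i},\qquad j=1,2,$$ be linear pencils of sizes $m_1$ and $m_2$, respectively, with $0\neq A_{1,0}\succeq0$. Assume that $S_{L_1}$ is bounded and that the linear span $\mathscr{S}_1$ of $A_{1,0},\dots,A_{1,n}$ contains a positive definite matrix. Then the following are equivalent: (i) $\mathfrak{S}_{L_1}\subseteq\mathfrak{S}_{L_2}$; (ii) there exist $\mu\in\mathbb{N}$ and $V\in\mathbb{R}^{\mu m_1\times m_2}$ such that $$L_2=V^*(I_\mu\otimes L_1)V.$$
   Context: A linear pencil of size $m$ in the variables $X_1,\dots,X_n$ is $L=A_0+\sum_{i=1}^nX_iA_i$ with real symmetric $m\times m$ matrices $A_i$. $V^*$ denotes the transpose, and $A\succeq0$ means real symmetric positive semidefinite. $S_L=\{x\in\mathbb{R}^n\mid L(x)\succeq0\}$. For an $n$-tuple $Z=(Z_1,\dots,Z_n)$ of real symmetric $d\times d$ matrices, $L(Z)=I_d\otimes A_0+\sum_{i=1}^nZ_i\otimes A_i$. The matricial spectrahedron $\mathfrak{S}_L$ is the set of all $n$-tuples $Z$ of real symmetric $d\times d$ matrices, over all $d\in\mathbb{N}$, with $L(Z)\succeq0$. The identity in (ii) is an identity of matrices of polynomials in $X_1,\dots,X_n$. *)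

theory Defs
  imports
    "HOL-Analysis.Analysis"
    "HOL-Library.Poly_Mapping"
    "Jordan_Normal_Form.Matrix"
begin

no_notation Matrix.vec_index (infixl \<open>$\<close> 100)

text \<open>
  Matrix sizes vary inside the statement, so matrices are taken from \<open>Jordan_Normal_Form\<close>.
  The number \<open>n\<close> of variables is fixed, so the variables are indexed by a finite type \<open>'n\<close>,
  and points of \<open>n\<close>-space are elements of \<open>real ^ 'n\<close>.
\<close>

definition symmetric_mat :: "real mat \<Rightarrow> bool" where
  "symmetric_mat A \<longleftrightarrow> square_mat A \<and> transpose_mat A = A"

definition psd_mat :: "real mat \<Rightarrow> bool" where
  "psd_mat A \<longleftrightarrow> symmetric_mat A \<and>
     (\<forall>v \<in> carrier_vec (dim_row A). v \<bullet> (A *\<^sub>v v) \<ge> 0)"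

definition pd_mat :: "real mat \<Rightarrow> bool" where
  "pd_mat A \<longleftrightarrow> symmetric_mat A \<and>
     (\<forall>v \<in> carrier_vec (dim_row A). v \<noteq> 0\<^sub>v (dim_row A) \<longrightarrow> v \<bullet> (A *\<^sub>v v) > 0)"

definition kronecker_prod :: "'a :: times mat \<Rightarrow> 'a mat \<Rightarrow> 'a mat" (infixl \<open>\<otimes>\<^sub>k\<close> 72) where
  "A \<otimes>\<^sub>k B = mat (dim_row A * dim_row B) (dim_col A * dim_col B)
     (\<lambda>(i, j). A $$ (i div dim_row B, j div dim_col B) * B $$ (i mod dim_row B, j mod dim_col B))"

text \<open>Matrices of all sizes share one type, so a sum of matrices needs its size \<open>m \<times> m\<close> as an
  argument.\<close>

definition sum_mats :: "nat \<Rightarrow> ('n :: finite \<Rightarrow> 'a :: comm_monoid_add mat) \<Rightarrow> 'a mat" where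
  "sum_mats m F = mat m m (\<lambda>ij. \<Sum>i \<in> UNIV. F i $$ ij)"

text \<open>Real polynomials in the variables \<open>X\<^sub>i\<close> with \<open>i :: 'n\<close>: finitely supported functions
  on the monomials \<open>'n \<Rightarrow>\<^sub>0 nat\<close>, multiplied by convolution.\<close>

type_synonym 'n rpoly = "('n \<Rightarrow>\<^sub>0 nat) \<Rightarrow>\<^sub>0 real"

definition poly_const :: "real \<Rightarrow> 'n rpoly" where
  "poly_const c = Poly_Mapping.single 0 c"

definition poly_var :: "'n \<Rightarrow> 'n rpoly" where
  "poly_var i = Poly_Mapping.single (Poly_Mapping.single i 1) 1"

abbreviation const_mat :: "real mat \<Rightarrow> 'n rpoly mat" where
  "const_mat A \<equiv> map_mat poly_const A"

text \<open>A linear pencil is given by its coefficients: \<open>A0\<close> and the family \<open>A\<close>.\<close>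

definition pencil_coeffs :: "nat \<Rightarrow> real mat \<Rightarrow> ('n :: finite \<Rightarrow> real mat) \<Rightarrow> bool" where
  "pencil_coeffs m A0 A \<longleftrightarrow>
     A0 \<in> carrier_mat m m \<and> symmetric_mat A0 \<and>
     (\<forall>i. A i \<in> carrier_mat m m \<and> symmetric_mat (A i))"

definition pencil :: "real mat \<Rightarrow> ('n :: finite \<Rightarrow> real mat) \<Rightarrow> 'n rpoly mat" where
  "pencil A0 A =
     const_mat A0 + sum_mats (dim_row A0) (\<lambda>i. poly_var i \<cdot>\<^sub>m const_mat (A i))"

definition pencil_at :: "real mat \<Rightarrow> ('n :: finite \<Rightarrow> real mat) \<Rightarrow> real ^ 'n \<Rightarrow> real mat" where
  "pencil_at A0 A x = A0 + sum_mats (dim_row A0) (\<lambda>i. (x $ i) \<cdot>\<^sub>m A i)"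

definition pencil_at_mats ::
    "nat \<Rightarrow> real mat \<Rightarrow> ('n :: finite \<Rightarrow> real mat) \<Rightarrow> ('n \<Rightarrow> real mat) \<Rightarrow> real mat" where
  "pencil_at_mats d A0 A Z =
     (1\<^sub>m d \<otimes>\<^sub>k A0) + sum_mats (d * dim_row A0) (\<lambda>i. Z i \<otimes>\<^sub>k A i)"

definition spectrahedron :: "real mat \<Rightarrow> ('n :: finite \<Rightarrow> real mat) \<Rightarrow> (real ^ 'n) set" where
  "spectrahedron A0 A = {x. psd_mat (pencil_at A0 A x)}"

definition matricial_spectrahedron ::
    "real mat \<Rightarrow> ('n :: finite \<Rightarrow> real mat) \<Rightarrow> ('n \<Rightarrow> real mat) set" where
  "matricial_spectrahedron A0 A =
     {Z. \<exists>d > 0. (\<forall>i. Z i \<in> carrier_mat d d \<and> symmetric_mat (Z i)) \<and>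
                 psd_mat (pencil_at_mats d A0 A Z)}"

definition pencil_span :: "real mat \<Rightarrow> ('n :: finite \<Rightarrow> real mat) \<Rightarrow> real mat set" where
  "pencil_span A0 A =
     {c0 \<cdot>\<^sub>m A0 + sum_mats (dim_row A0) (\<lambda>i. c i \<cdot>\<^sub>m A i) | c0 c. True}"

end

theory Submission
  imports Defs "Jordan_Normal_Form.Determinant"
begin

text \<open>
  Write \<open>L\<^sub>1\<close> with coefficients \<open>A\<^sub>0, \<dots>, A\<^sub>n\<close> and \<open>L\<^sub>2\<close> with coefficients \<open>B\<^sub>0, \<dots>, B\<^sub>n\<close>.
  The compression identity says coefficientwise that \<open>B\<^sub>k = \<Sum>\<^sub>\<kappa> V\<^sub>\<kappa>\<^sup>* A\<^sub>k V\<^sub>\<kappa>\<close>, where the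
  \<open>V\<^sub>\<kappa>\<close> are the blocks of \<open>V\<close>. Such an identity visibly carries positivity of \<open>L\<^sub>1(Z)\<close> over to
  \<open>L\<^sub>2(Z)\<close>. The content is the converse: the inclusion makes \<open>A\<^sub>k \<mapsto> B\<^sub>k\<close> a completely positive
  map, and a completely positive map has this form.

  Complete positivity means: whenever \<open>\<Sum>\<^sub>k D\<^sub>k \<otimes> A\<^sub>k\<close> is positive semidefinite for symmetric
  \<open>D\<^sub>k\<close>, so is \<open>\<Sum>\<^sub>k D\<^sub>k \<otimes> B\<^sub>k\<close>. The inclusion of matricial spectrahedra is the case \<open>D\<^sub>0 = I\<close>.
  The reduction to this case (\<open>completely_positive_if_monic_inclusion\<close>) is a congruence by
  a factor of \<open>D\<^sub>0\<close>, after a small multiple of \<open>I\<close> has been added to \<open>D\<^sub>0\<close>; it needs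
  \<open>D\<^sub>0\<close> to be positive semidefinite. That is where boundedness enters: if
  \<open>\<Sum>\<^sub>k c\<^sub>k A\<^sub>k\<close> is positive semidefinite with \<open>c\<^sub>0 < 0\<close>, then \<open>(c\<^sub>1, \<dots>, c\<^sub>n)\<close> spans a ray in the
  spectrahedron, hence vanishes, and then \<open>A\<^sub>0\<close> is both positive and negative semidefinite
  (\<open>bounded_spectrahedron_homogeneous_coefficient_nonneg\<close>).

  For the second step (\<open>completely_positive_choi_matrix\<close>), consider the convex cone of all tuples
  \<open>(\<Phi>\<^sub>C(A\<^sub>k))\<^sub>k\<close>, where \<open>\<Phi>\<^sub>C\<close> is the linear map with positive semidefinite Choi matrix \<open>C\<close>.
  A positive definite matrix in the span of the \<open>A\<^sub>k\<close> bounds the trace of \<open>C\<close> in terms of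
  \<open>\<Phi>\<^sub>C\<close>, so the cone has a point nearest to \<open>(B\<^sub>k)\<^sub>k\<close>. Let \<open>D\<close> be the difference of the two.
  Pairing \<open>D\<close> with the cone gives nonnegative numbers; on Choi matrices of rank one this says
  that \<open>\<Sum>\<^sub>k D\<^sub>k \<otimes> A\<^sub>k\<close> is positive semidefinite. By complete positivity
  \<open>\<Sum>\<^sub>k D\<^sub>k \<otimes> B\<^sub>k\<close> is positive semidefinite too, and its value at the vectorised identity matrix is
  \<open>\<Sum>\<^sub>k \<langle>D\<^sub>k, B\<^sub>k\<rangle>\<close>. But at the nearest point this sum is at most \<open>- \<parallel>D\<parallel>\<^sup>2\<close>. So \<open>D = 0\<close>, and
  \<open>B\<^sub>k = \<Phi>\<^sub>C(A\<^sub>k)\<close>. A Gram factorisation of \<open>C\<close> yields the matrices \<open>V\<^sub>\<kappa>\<close>. This replaces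
  the usual combination of Arveson's extension theorem with Choi's theorem.

  Tensor products have pairs as row indices. Therefore the argument is carried out for matrices
  given as functions on finite index sets of arbitrary type, and is transferred to matrices with
  natural-number indices only at the end.
\<close>

section \<open>Positive semidefinite matrices on finite index sets\<close>
definition quad :: "'i set \<Rightarrow> ('i \<Rightarrow> 'i \<Rightarrow> real) \<Rightarrow> ('i \<Rightarrow> real) \<Rightarrow> real" where
  "quad I M x = (\<Sum>i\<in>I. \<Sum>j\<in>I. x i * M i j * x j)"

definition psd_on :: "'i set \<Rightarrow> ('i \<Rightarrow> 'i \<Rightarrow> real) \<Rightarrow> bool" where
  "psd_on I M \<longleftrightarrow> (\<forall>i\<in>I. \<forall>j\<in>I. M i j = M j i) \<and> (\<forall>x. 0 \<le> quad I M x)"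

lemma psd_onI:
  assumes "\<And>i j. i \<in> I \<Longrightarrow> j \<in> I \<Longrightarrow> M i j = M j i" and "\<And>x. 0 \<le> quad I M x"
  shows "psd_on I M"
  using assms by (auto simp: psd_on_def)

lemma psd_on_sym: "psd_on I M \<Longrightarrow> i \<in> I \<Longrightarrow> j \<in> I \<Longrightarrow> M i j = M j i"
  by (auto simp: psd_on_def)

lemma psd_on_quad: "psd_on I M \<Longrightarrow> 0 \<le> quad I M x"
  by (auto simp: psd_on_def)

lemma quad_cong:
  assumes "\<And>i j. i \<in> I \<Longrightarrow> j \<in> I \<Longrightarrow> M i j = N i j" "\<And>i. i \<in> I \<Longrightarrow> x i = y i"
  shows "quad I M x = quad I N y"
  unfolding quad_def using assms by (intro sum.cong refl) simp

lemma psd_on_cong: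
  assumes "\<And>i j. i \<in> I \<Longrightarrow> j \<in> I \<Longrightarrow> M i j = N i j"
  shows "psd_on I M \<longleftrightarrow> psd_on I N"
proof -
  have "quad I M x = quad I N x" for x by (rule quad_cong) (use assms in auto)
  then show ?thesis unfolding psd_on_def using assms by metis
qed

lemma quad_add: "quad I (\<lambda>i j. M i j + N i j) x = quad I M x + quad I N x"
  by (simp add: quad_def algebra_simps sum.distrib)

lemma quad_scale: "quad I (\<lambda>i j. c * M i j) x = c * quad I M x"
  by (simp add: quad_def sum_distrib_left algebra_simps)

lemma quad_scale_vec: "quad I M (\<lambda>i. c * x i) = c\<^sup>2 * quad I M x"
  by (simp add: quad_def sum_distrib_left power2_eq_square algebra_simps)

lemma psd_on_add: "psd_on I M \<Longrightarrow> psd_on I N \<Longrightarrow> psd_on I (\<lambda>i j. M i j + N i j)"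
  by (auto simp: psd_on_def quad_add)

lemma psd_on_scale: "psd_on I M \<Longrightarrow> 0 \<le> c \<Longrightarrow> psd_on I (\<lambda>i j. c * M i j)"
  by (auto simp: psd_on_def quad_scale)

lemma psd_on_zero: "psd_on I (\<lambda>i j. 0)"
  by (auto simp: psd_on_def quad_def)

lemma quad_identity:
  assumes "finite I"
  shows "quad I (\<lambda>i j. if i = j then 1 else 0) x = (\<Sum>i\<in>I. (x i)\<^sup>2)"
  unfolding quad_def
proof (rule sum.cong [OF refl])
  fix i assume i: "i \<in> I"
  have "(\<Sum>j\<in>I. x i * (if i = j then 1 else 0) * x j) = (\<Sum>j\<in>I. if i = j then x i * x j else 0)"
    by (rule sum.cong) auto
  then show "(\<Sum>j\<in>I. x i * (if i = j then 1 else 0) * x j) = (x i)\<^sup>2"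
    using i assms by (simp add: sum.delta' power2_eq_square)
qed

lemma quad_insert:
  assumes "finite I" "a \<notin> I" "\<And>j. j \<in> I \<Longrightarrow> M j a = M a j"
  shows "quad (insert a I) M x =
    M a a * (x a)\<^sup>2 + 2 * x a * (\<Sum>j\<in>I. M a j * x j) + quad I M x"
proof -
  have 1: "(\<Sum>j\<in>I. x a * M a j * x j) = x a * (\<Sum>j\<in>I. M a j * x j)"
    by (simp add: sum_distrib_left mult.assoc)
  have 2: "(\<Sum>i\<in>I. x i * M i a * x a) = x a * (\<Sum>j\<in>I. M a j * x j)"
    unfolding sum_distrib_left by (rule sum.cong) (use assms in auto)
  show ?thesis
    using assms(1,2) by (simp add: quad_def sum.distrib 1 2) (simp add: power2_eq_square algebra_simps)
qed

lemma quad_delta: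
  assumes "finite I" "a \<in> I"
  shows "quad I M (\<lambda>i. if i = a then 1 else 0) = M a a"
proof -
  have "quad I M (\<lambda>i. if i = a then 1 else 0) =
      (\<Sum>i\<in>I. if i = a then (\<Sum>j\<in>I. if j = a then M a a else 0) else 0)"
    unfolding quad_def by (intro sum.cong refl) (auto intro: sum.cong)
  then show ?thesis using assms by simp
qed

lemma psd_on_diag: "finite I \<Longrightarrow> psd_on I M \<Longrightarrow> a \<in> I \<Longrightarrow> 0 \<le> M a a"
  using quad_delta [of I a M] psd_on_quad by metis

lemma psd_on_subset:
  assumes "finite I" "J \<subseteq> I" "psd_on I M"
  shows "psd_on J M"
proof (rule psd_onI)
  fix x
  have "quad I M (\<lambda>i. if i \<in> J then x i else 0) = quad J M x"
    unfolding quad_def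
  proof (rule sum.mono_neutral_cong_right [OF assms(1,2)])
    fix i assume i: "i \<in> J"
    show "(\<Sum>j\<in>I. (if i \<in> J then x i else 0) * M i j * (if j \<in> J then x j else 0)) =
      (\<Sum>j\<in>J. x i * M i j * x j)"
      by (rule sum.mono_neutral_cong_right [OF assms(1,2)]) (use i in auto)
  qed auto
  then show "0 \<le> quad J M x" using psd_on_quad [OF assms(3)] by metis
qed (use assms in \<open>auto simp: psd_on_def\<close>)

text \<open>A positive semidefinite matrix is controlled by its trace: \<open>2 |M\<^sub>i\<^sub>j| \<le> M\<^sub>i\<^sub>i + M\<^sub>j\<^sub>j\<close> follows by
  evaluating the form at \<open>e\<^sub>i + e\<^sub>j\<close> and \<open>e\<^sub>i - e\<^sub>j\<close>.\<close>
lemma psd_on_entry_le_trace: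
  assumes fin: "finite I" and psd: "psd_on I M" and ij: "i \<in> I" "j \<in> I"
  shows "\<bar>M i j\<bar> \<le> (\<Sum>k\<in>I. M k k)"
proof (cases "i = j")
  case True
  have "M i i \<le> (\<Sum>k\<in>I. M k k)"
    by (rule member_le_sum) (use assms psd_on_diag in auto)
  then show ?thesis using True psd_on_diag [OF fin psd, of i] ij by simp
next
  case False
  have 2: "psd_on {i, j} M" by (rule psd_on_subset [OF fin _ psd]) (use ij in auto)
  have q: "quad {i, j} M x = M i i * (x i)\<^sup>2 + 2 * x i * (M i j * x j) + M j j * (x j)\<^sup>2" for x
    using False psd_on_sym [OF psd ij]
    by (simp add: quad_insert) (simp add: quad_def power2_eq_square algebra_simps)
  have "0 \<le> M i i + 2 * M i j + M j j"
    using psd_on_quad [OF 2, of "\<lambda>_. 1"] by (simp add: q)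
  moreover have "0 \<le> M i i - 2 * M i j + M j j"
    using psd_on_quad [OF 2, of "\<lambda>k. if k = i then 1 else -1"] False by (simp add: q)
  moreover have "M i i + M j j \<le> (\<Sum>k\<in>I. M k k)"
  proof -
    have "(\<Sum>k\<in>{i, j}. M k k) \<le> (\<Sum>k\<in>I. M k k)"
      by (rule sum_mono2) (use assms psd_on_diag in auto)
    then show ?thesis using False by simp
  qed
  moreover have "0 \<le> M i i" "0 \<le> M j j" using psd_on_diag [OF fin psd] ij by auto
  ultimately show ?thesis by linarith
qed

text \<open>The Cholesky factorisation, by adding one index at a time. If the new diagonal entry is
  zero, positivity forces its whole row to vanish; otherwise the Schur complement is again positive
  semidefinite. The number of columns of the factor equals the number of rows, which makes the
  factor of a definite matrix invertible.\<close>
lemma psd_on_gram: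
  assumes "finite I" "psd_on I M"
  shows "\<exists>F. \<forall>i\<in>I. \<forall>j\<in>I. M i j = (\<Sum>s\<in>I. F i s * F j s)"
  using assms
proof (induction I arbitrary: M rule: finite_induct)
  case empty
  then show ?case by simp
next
  case (insert a I)
  have sym: "M i j = M j i" if "i \<in> insert a I" "j \<in> insert a I" for i j
    using psd_on_sym [OF insert.prems that] .
  define S where "S x = (\<Sum>j\<in>I. M a j * x j)" for x
  have q: "quad (insert a I) M x = M a a * (x a)\<^sup>2 + 2 * x a * S x + quad I M x" for x
    unfolding S_def by (rule quad_insert) (use insert.hyps sym in auto)
  have nn: "0 \<le> M a a * t\<^sup>2 + 2 * t * S x + quad I M x" for t x
  proof -
    have "S (x(a := t)) = S x" "quad I M (x(a := t)) = quad I M x"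
      unfolding S_def quad_def using insert.hyps by (auto intro!: sum.cong)
    then show ?thesis using psd_on_quad [OF insert.prems, of "x(a := t)"] q [of "x(a := t)"] by simp
  qed
  show ?case
  proof (cases "M a a = 0")
    case True
    have zero: "M a j = 0" if j: "j \<in> I" for j
    proof (rule ccontr)
      assume n: "M a j \<noteq> 0"
      let ?x = "\<lambda>i. if i = j then 1 else 0 :: real"
      have "S ?x = (\<Sum>i\<in>I. if i = j then M a j else 0)" unfolding S_def by (rule sum.cong) auto
      then have S: "S ?x = M a j" using insert.hyps j by simp
      \<comment> \<open>The quadratic form is affine in the new coordinate, with slope \<open>2 * M a j\<close>; this value
        of the coordinate makes it \<open>-1\<close>.\<close>
      have "0 \<le> M a a * (- (quad I M ?x + 1) / (2 * M a j))\<^sup>2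
          + 2 * (- (quad I M ?x + 1) / (2 * M a j)) * S ?x + quad I M ?x"
        by (rule nn)
      then show False using n by (simp add: S True field_simps)
    qed
    have "psd_on I M" by (rule psd_on_subset [OF _ _ insert.prems]) (use insert.hyps in auto)
    from insert.IH [OF this] obtain F
      where F: "\<And>i j. i \<in> I \<Longrightarrow> j \<in> I \<Longrightarrow> M i j = (\<Sum>s\<in>I. F i s * F j s)" by blast
    define G where "G i s = (if i = a \<or> s = a then 0 else F i s)" for i s
    have "M i j = (\<Sum>s\<in>insert a I. G i s * G j s)" if "i \<in> insert a I" "j \<in> insert a I" for i j
    proof -
      have "(\<Sum>s\<in>I. G i s * G j s) = M i j"
      proof (cases "i = a \<or> j = a")
        case True
        then show ?thesis using that zero sym [OF that] \<open>M a a = 0\<close> by (auto simp: G_def)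
      next
        case False
        then show ?thesis using that insert.hyps unfolding G_def
          by (subst F) (auto intro!: sum.cong)
      qed
      then show ?thesis using insert.hyps by (simp add: G_def)
    qed
    then show ?thesis by blast
  next
    case False
    then have pos: "0 < M a a" using psd_on_diag [OF _ insert.prems, of a] insert.hyps by simp
    define N where "N i j = M i j - M a i * M a j / M a a" for i j
    have "psd_on I N"
    proof (rule psd_onI)
      fix x
      have "quad I N x = quad I M x - (\<Sum>i\<in>I. \<Sum>j\<in>I. (M a i * x i) * (M a j * x j)) / M a a"
        by (simp add: quad_def N_def algebra_simps sum_subtractf sum_divide_distrib)
      also have "\<dots> = quad I M x - (S x)\<^sup>2 / M a a"
        by (simp add: S_def sum_product power2_eq_square)
      \<comment> \<open>The Schur complement is the minimum over the new coordinate, attained at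
        \<open>- S x / M a a\<close>.\<close>
      finally have "quad I N x = M a a * (- S x / M a a)\<^sup>2 + 2 * (- S x / M a a) * S x + quad I M x"
        using pos by (simp add: field_simps power2_eq_square)
      then show "0 \<le> quad I N x" using nn [of "- S x / M a a" x] by (simp only:)
    qed (use sym in \<open>auto simp: N_def\<close>)
    from insert.IH [OF this] obtain F
      where F: "\<And>i j. i \<in> I \<Longrightarrow> j \<in> I \<Longrightarrow> N i j = (\<Sum>s\<in>I. F i s * F j s)" by blast
    define G where
      "G i s = (if s = a then M a i / sqrt (M a a) else if i = a then 0 else F i s)" for i s
    have "M i j = (\<Sum>s\<in>insert a I. G i s * G j s)" if "i \<in> insert a I" "j \<in> insert a I" for i j
    proof -
      have "(\<Sum>s\<in>I. G i s * G j s) = N i j"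
      proof (cases "i = a \<or> j = a")
        case True
        then have "N i j = 0" using sym [OF that] pos by (auto simp: N_def)
        moreover have "(\<Sum>s\<in>I. G i s * G j s) = 0"
          by (rule sum.neutral) (use True insert.hyps in \<open>auto simp: G_def\<close>)
        ultimately show ?thesis by simp
      next
        case False
        then show ?thesis using that insert.hyps unfolding G_def
          by (subst F) (auto intro!: sum.cong)
      qed
      then show ?thesis using insert.hyps pos
        by (simp add: G_def N_def real_sqrt_mult_self)
    qed
    then show ?thesis by blast
  qed
qed

text \<open>The cone of positive semidefinite matrices is contained in its dual: a Gram factorisation of
  \<open>C\<close> writes the trace pairing as a sum of values of the form of \<open>M\<close>.\<close>
lemma psd_on_pairing_nonneg:
  assumes "finite I" "psd_on I C" "psd_on I M"
  shows "0 \<le> (\<Sum>i\<in>I. \<Sum>j\<in>I. C i j * M i j)"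
proof -
  obtain F where F: "\<And>i j. i \<in> I \<Longrightarrow> j \<in> I \<Longrightarrow> C i j = (\<Sum>s\<in>I. F i s * F j s)"
    using psd_on_gram [OF assms(1,2)] by blast
  have "(\<Sum>i\<in>I. \<Sum>j\<in>I. C i j * M i j) = (\<Sum>i\<in>I. \<Sum>j\<in>I. \<Sum>s\<in>I. F i s * M i j * F j s)"
    by (simp add: F sum_distrib_right) (simp add: mult_ac)
  also have "\<dots> = (\<Sum>i\<in>I. \<Sum>s\<in>I. \<Sum>j\<in>I. F i s * M i j * F j s)"
    by (rule sum.cong [OF refl], rule sum.swap)
  also have "\<dots> = (\<Sum>s\<in>I. quad I M (\<lambda>i. F i s))"
    unfolding quad_def by (rule sum.swap)
  also have "\<dots> \<ge> 0" by (intro sum_nonneg psd_on_quad assms)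
  finally show ?thesis .
qed

text \<open>Tychonoff's theorem for a power of a compact set, with functions carrying the product
  topology. It supplies the minimisers below without a choice of coordinates.\<close>
lemma compact_function_box: "compact {f :: 'a \<Rightarrow> 'b :: topological_space. \<forall>i. f i \<in> K}"
  if "compact K"
proof -
  have "compactin (product_topology (\<lambda>_::'a. euclidean :: 'b topology) UNIV) (PiE UNIV (\<lambda>_. K))"
    unfolding compactin_PiE using that by simp
  then have "compact (PiE (UNIV :: 'a set) (\<lambda>_. K))"
    by (simp add: euclidean_product_topology)
  moreover have "PiE (UNIV :: 'a set) (\<lambda>_. K) = {f. \<forall>i. f i \<in> K}" by auto
  ultimately show ?thesis by simp
qed

lemma continuous_on_quad [continuous_intros]:
  fixes f :: "'t :: topological_space \<Rightarrow> 'i \<Rightarrow> 'i \<Rightarrow> real"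
  assumes "\<And>i j. continuous_on X (\<lambda>t. f t i j)" "\<And>i. continuous_on X (\<lambda>t. x t i)"
  shows "continuous_on X (\<lambda>t. quad I (f t) (x t))"
  unfolding quad_def by (intro continuous_intros assms)

text \<open>A positive definite form has a positive minimum on the unit sphere.\<close>
lemma pd_on_coercive:
  assumes fin: "finite I"
    and pd: "\<And>x. (\<exists>i\<in>I. x i \<noteq> 0) \<Longrightarrow> 0 < quad I P x"
  shows "\<exists>\<delta>>0. \<forall>x. \<delta> * (\<Sum>i\<in>I. (x i)\<^sup>2) \<le> quad I P x"
proof (cases "I = {}")
  case True
  then show ?thesis by (auto simp: quad_def intro!: exI [of _ 1])
next
  case False
  then obtain a where a: "a \<in> I" by auto
  \<comment> \<open>The box bounds the coordinates outside \<open>I\<close> as well, for the sake of compactness.\<close>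
  define K where "K = {x :: 'a \<Rightarrow> real. \<forall>i. x i \<in> {-1..1}} \<inter> {x. (\<Sum>i\<in>I. (x i)\<^sup>2) = 1}"
  have "compact K"
    unfolding K_def
    by (intro compact_Int_closed compact_function_box closed_Collect_eq)
       (auto intro!: continuous_intros)
  moreover have "(\<lambda>i. if i = a then 1 else 0) \<in> K"
    using fin a unfolding K_def by (auto simp: if_distrib [of "\<lambda>r. r\<^sup>2"] cong: if_cong)
  moreover have "continuous_on K (quad I P)"
    by (rule continuous_on_subset [of UNIV], rule continuous_on_quad) (simp_all)
  ultimately obtain z where z: "z \<in> K" "\<And>y. y \<in> K \<Longrightarrow> quad I P z \<le> quad I P y"
    using continuous_attains_inf [of K "quad I P"] by blast
  have "\<exists>i\<in>I. z i \<noteq> 0"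
  proof (rule ccontr)
    assume "\<not> ?thesis"
    then have "(\<Sum>i\<in>I. (z i)\<^sup>2) = 0" by simp
    then show False using z(1) by (simp add: K_def)
  qed
  then have pos: "0 < quad I P z" by (rule pd)
  have "quad I P z * (\<Sum>i\<in>I. (x i)\<^sup>2) \<le> quad I P x" for x
  proof -
    define n where "n = (\<Sum>i\<in>I. (x i)\<^sup>2)"
    have n0: "0 \<le> n" unfolding n_def by (simp add: sum_nonneg)
    show ?thesis
    proof (cases "n = 0")
      case True
      then have "\<forall>i\<in>I. x i = 0" using fin by (simp add: n_def sum_nonneg_eq_0_iff)
      then have "quad I P x = 0" by (simp add: quad_def)
      then show ?thesis using True by (simp add: n_def)
    next
      case False
      define y where "y i = (if i \<in> I then (1 / sqrt n) * x i else 0)" for i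
      have yn: "(y i)\<^sup>2 = (x i)\<^sup>2 / n" if "i \<in> I" for i
        using that n0 by (simp add: y_def power_divide)
      have s: "(\<Sum>i\<in>I. (y i)\<^sup>2) = 1"
        using False by (simp add: yn n_def flip: sum_divide_distrib)
      have "\<bar>y i\<bar> \<le> 1" for i
      proof (cases "i \<in> I")
        case True
        then have "(y i)\<^sup>2 \<le> (\<Sum>i\<in>I. (y i)\<^sup>2)" using fin by (intro member_le_sum) auto
        then show ?thesis using s by (simp add: abs_square_le_1)
      qed (simp add: y_def)
      then have "y \<in> K" using s by (auto simp: K_def abs_le_iff)
      then have "quad I P z \<le> quad I P y" by (rule z)
      also have "quad I P y = quad I P (\<lambda>i. (1 / sqrt n) * x i)"
        by (rule quad_cong) (auto simp: y_def)
      also have "\<dots> = quad I P x / n" using n0 by (subst quad_scale_vec) (simp add: power_divide)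
      finally show ?thesis using False n0 by (simp add: n_def field_simps)
    qed
  qed
  then show ?thesis using pos by blast
qed

lemma quad_reindex:
  assumes "inj_on h J"
  shows "quad (h ` J) M x = quad J (\<lambda>i j. M (h i) (h j)) (\<lambda>i. x (h i))"
  using assms by (simp add: quad_def sum.reindex)

lemma psd_on_reindex:
  assumes inj: "inj_on h J"
  shows "psd_on (h ` J) M \<longleftrightarrow> psd_on J (\<lambda>i j. M (h i) (h j))"
proof -
  have "quad J (\<lambda>i j. M (h i) (h j)) x = quad (h ` J) M (\<lambda>i. x (inv_into J h i))" for x
    unfolding quad_reindex [OF inj] by (rule quad_cong) (use inj in auto)
  then have "(\<forall>x. 0 \<le> quad (h ` J) M x) \<longleftrightarrow> (\<forall>x. 0 \<le> quad J (\<lambda>i j. M (h i) (h j)) x)"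
    using quad_reindex [OF inj] by metis
  then show ?thesis
    unfolding psd_on_def by simp
qed

lemma sum_Times: "(\<Sum>u\<in>A \<times> B. f u) = (\<Sum>a\<in>A. \<Sum>b\<in>B. f (a, b))"
  by (simp add: sum.cartesian_product)

lemma sum_rotate3:
  "(\<Sum>k\<in>K. \<Sum>a\<in>A. \<Sum>b\<in>B. f k a b) = (\<Sum>a\<in>A. \<Sum>b\<in>B. \<Sum>k\<in>K. f k a b)"
  by (subst sum.swap) (rule sum.cong [OF refl], rule sum.swap)

section \<open>Completely positive maps have Choi matrices\<close>

text \<open>A quadratic polynomial that vanishes at \<open>0\<close> and is nonnegative to the right of \<open>0\<close> has
  nonnegative slope there.\<close>
lemma nonneg_if_nonneg_near_zero:
  fixes a c :: real
  assumes c: "0 \<le> c" and "\<And>t. 0 < t \<Longrightarrow> t \<le> 1 \<Longrightarrow> 0 \<le> t * (2 * a + t * c)"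
  shows "0 \<le> a"
proof (rule ccontr)
  assume "\<not> 0 \<le> a"
  then have a: "a < 0" by simp
  define t where "t = min 1 (- a / (c + 1))"
  have t: "0 < t" "t \<le> 1" using a c by (auto simp: t_def intro!: divide_neg_pos)
  have "t * c \<le> (- a / (c + 1)) * c" using c by (intro mult_right_mono) (auto simp: t_def)
  also have "\<dots> \<le> - a" using a c by (simp add: field_simps)
  finally have "2 * a + t * c < 0" using a by simp
  then have "t * (2 * a + t * c) < 0" using t by (simp add: mult_pos_neg)
  then show False using assms(2) [OF t] by simp
qed

text \<open>First-order optimality for the squared distance to \<open>b\<close> on a convex cone: moving from the
  nearest point \<open>v\<close> towards \<open>v + w\<close>, and from \<open>v\<close> towards the apex, cannot decrease the distance.
  Together the two inequalities say that \<open>v - b\<close> separates \<open>b\<close> from the cone.\<close>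
lemma nearest_point_of_cone:
  fixes v b :: "'u \<Rightarrow> real"
  assumes add: "\<And>v w. v \<in> K \<Longrightarrow> w \<in> K \<Longrightarrow> (\<lambda>u. v u + w u) \<in> K"
    and scale: "\<And>v t. v \<in> K \<Longrightarrow> 0 \<le> t \<Longrightarrow> (\<lambda>u. t * v u) \<in> K"
    and v: "v \<in> K"
    and nearest: "\<And>w. w \<in> K \<Longrightarrow> (\<Sum>u\<in>X. (v u - b u)\<^sup>2) \<le> (\<Sum>u\<in>X. (w u - b u)\<^sup>2)"
  shows "w \<in> K \<Longrightarrow> 0 \<le> (\<Sum>u\<in>X. (v u - b u) * w u)"
    and "(\<Sum>u\<in>X. (v u - b u) * v u) \<le> 0"
proof -
  have expand: "(\<Sum>u\<in>X. (v u + t * w u - b u)\<^sup>2) = (\<Sum>u\<in>X. (v u - b u)\<^sup>2) +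
      t * (2 * (\<Sum>u\<in>X. (v u - b u) * w u) + t * (\<Sum>u\<in>X. (w u)\<^sup>2))" for t w
    unfolding sum_distrib_left sum.distrib [symmetric]
    by (rule sum.cong) (auto simp: power2_eq_square algebra_simps)
  show "0 \<le> (\<Sum>u\<in>X. (v u - b u) * w u)" if w: "w \<in> K"
  proof (rule nonneg_if_nonneg_near_zero)
    fix t :: real assume "0 < t"
    then have "(\<lambda>u. v u + t * w u) \<in> K" using add [OF v scale [OF w]] by simp
    from nearest [OF this]
    show "0 \<le> t * (2 * (\<Sum>u\<in>X. (v u - b u) * w u) + t * (\<Sum>u\<in>X. (w u)\<^sup>2))"
      unfolding expand by simp
  qed (simp add: sum_nonneg)
  have "0 \<le> (\<Sum>u\<in>X. (v u - b u) * - v u)"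
  proof (rule nonneg_if_nonneg_near_zero)
    fix t :: real assume "0 < t" "t \<le> 1"
    then have "(\<lambda>u. (1 - t) * v u) \<in> K" using scale [OF v] by simp
    then have "(\<lambda>u. v u + t * - v u) \<in> K" by (simp add: algebra_simps)
    from nearest [OF this]
    show "0 \<le> t * (2 * (\<Sum>u\<in>X. (v u - b u) * - v u) + t * (\<Sum>u\<in>X. (- v u)\<^sup>2))"
      unfolding expand by simp
  qed (simp add: sum_nonneg)
  then show "(\<Sum>u\<in>X. (v u - b u) * v u) \<le> 0" by (simp add: sum_negf)
qed

definition kron_sum ::
    "('k :: finite \<Rightarrow> 's \<Rightarrow> 's \<Rightarrow> real) \<Rightarrow> ('k \<Rightarrow> 'p \<Rightarrow> 'p \<Rightarrow> real) \<Rightarrow> 's \<times> 'p \<Rightarrow> 's \<times> 'p \<Rightarrow> real" where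
  "kron_sum Z A u v = (\<Sum>k\<in>UNIV. Z k (fst u) (fst v) * A k (snd u) (snd v))"

text \<open>The linear map whose value at the matrix unit \<open>E\<^sub>p\<^sub>q\<close> is the block \<open>(C (a, p) (b, q))\<^sub>a\<^sub>b\<close>;
  its Choi matrix is \<open>C\<close>.\<close>
definition choi_map ::
    "'i set \<Rightarrow> ('j \<times> 'i \<Rightarrow> 'j \<times> 'i \<Rightarrow> real) \<Rightarrow> ('i \<Rightarrow> 'i \<Rightarrow> real) \<Rightarrow> 'j \<Rightarrow> 'j \<Rightarrow> real" where
  "choi_map I C M a b = (\<Sum>p\<in>I. \<Sum>q\<in>I. C (a, p) (b, q) * M p q)"

text \<open>Pairing the values \<open>\<Phi>\<^sub>C(A\<^sub>k)\<close> with \<open>D\<^sub>k\<close> is the trace pairing of \<open>C\<close> with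
  \<open>\<Sum>\<^sub>k D\<^sub>k \<otimes> A\<^sub>k\<close>. This identity connects the dual of the cone of tuples \<open>\<Phi>\<^sub>C(A\<^sub>k)\<close>
  with positivity of tensors.\<close>
lemma choi_map_pairing:
  fixes A :: "'k :: finite \<Rightarrow> 'i \<Rightarrow> 'i \<Rightarrow> real"
  shows "(\<Sum>k\<in>UNIV. \<Sum>a\<in>J. \<Sum>b\<in>J. D k a b * choi_map I C (A k) a b) =
    (\<Sum>u\<in>J \<times> I. \<Sum>v\<in>J \<times> I. C u v * kron_sum D A u v)"
proof -
  have "(\<Sum>k\<in>UNIV. \<Sum>a\<in>J. \<Sum>b\<in>J. D k a b * choi_map I C (A k) a b) =
      (\<Sum>a\<in>J. \<Sum>b\<in>J. \<Sum>k\<in>UNIV. \<Sum>p\<in>I. \<Sum>q\<in>I. C (a, p) (b, q) * (D k a b * A k p q))"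
    by (subst sum_rotate3) (simp add: choi_map_def sum_distrib_left mult_ac)
  also have "\<dots> = (\<Sum>a\<in>J. \<Sum>b\<in>J. \<Sum>p\<in>I. \<Sum>q\<in>I. \<Sum>k\<in>UNIV. C (a, p) (b, q) * (D k a b * A k p q))"
    by (rule sum.cong [OF refl], rule sum.cong [OF refl], rule sum_rotate3)
  also have "\<dots> = (\<Sum>a\<in>J. \<Sum>b\<in>J. \<Sum>p\<in>I. \<Sum>q\<in>I. C (a, p) (b, q) * kron_sum D A (a, p) (b, q))"
    by (simp add: kron_sum_def sum_distrib_left)
  also have "\<dots> = (\<Sum>a\<in>J. \<Sum>p\<in>I. \<Sum>b\<in>J. \<Sum>q\<in>I. C (a, p) (b, q) * kron_sum D A (a, p) (b, q))"
    by (rule sum.cong [OF refl], rule sum.swap)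
  finally show ?thesis by (simp add: sum_Times)
qed

lemma choi_map_linear:
  "(\<Sum>k\<in>K. c k * choi_map I C (A k) a b) = choi_map I C (\<lambda>p q. \<Sum>k\<in>K. c k * A k p q) a b"
proof -
  have "(\<Sum>k\<in>K. c k * choi_map I C (A k) a b) =
      (\<Sum>k\<in>K. \<Sum>p\<in>I. \<Sum>q\<in>I. C (a, p) (b, q) * (c k * A k p q))"
    by (simp add: choi_map_def sum_distrib_left mult_ac)
  also have "\<dots> = choi_map I C (\<lambda>p q. \<Sum>k\<in>K. c k * A k p q) a b"
    by (subst sum_rotate3) (simp add: choi_map_def sum_distrib_left)
  finally show ?thesis .
qed

lemma choi_map_add: "choi_map I (\<lambda>u v. C u v + C' u v) M a b = choi_map I C M a b + choi_map I C' M a b"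
  by (simp add: choi_map_def algebra_simps sum.distrib)

lemma choi_map_scale: "choi_map I (\<lambda>u v. t * C u v) M a b = t * choi_map I C M a b"
  by (simp add: choi_map_def sum_distrib_left mult_ac)

lemma choi_map_cong:
  assumes "\<And>u v. u \<in> J \<times> I \<Longrightarrow> v \<in> J \<times> I \<Longrightarrow> C u v = C' u v" "a \<in> J" "b \<in> J"
  shows "choi_map I C M a b = choi_map I C' M a b"
  unfolding choi_map_def using assms by (intro sum.cong refl) auto

lemma choi_map_sym:
  assumes psd: "psd_on (J \<times> I) C" and sym: "\<And>p q. p \<in> I \<Longrightarrow> q \<in> I \<Longrightarrow> M p q = M q p"
    and ab: "a \<in> J" "b \<in> J"
  shows "choi_map I C M a b = choi_map I C M b a"
proof -
  have "choi_map I C M a b = (\<Sum>p\<in>I. \<Sum>q\<in>I. C (b, q) (a, p) * M q p)"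
    unfolding choi_map_def using ab sym psd_on_sym [OF psd] by (intro sum.cong refl) auto
  also have "\<dots> = choi_map I C M b a"
    unfolding choi_map_def by (rule sum.swap)
  finally show ?thesis .
qed

text \<open>Since \<open>P - \<delta> I\<close> is positive semidefinite, its image under \<open>\<Phi>\<^sub>C\<close> has a nonnegative
  diagonal, and the trace of \<open>\<Phi>\<^sub>C(I)\<close> is the trace of \<open>C\<close>. This is the compactness estimate behind the existence of a nearest
  point.\<close>
lemma choi_trace_bound:
  assumes fin: "finite I" and psd: "psd_on (J \<times> I) C"
    and symP: "\<And>p q. p \<in> I \<Longrightarrow> q \<in> I \<Longrightarrow> P p q = P q p"
    and coercive: "\<And>x. \<delta> * (\<Sum>p\<in>I. (x p)\<^sup>2) \<le> quad I P x"
    and fJ: "finite J"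
  shows "\<delta> * (\<Sum>u\<in>J \<times> I. C u u) \<le> (\<Sum>a\<in>J. choi_map I C P a a)"
proof -
  define N where "N p q = P p q + (- \<delta>) * (if p = q then 1 else 0)" for p q
  have "psd_on I N"
  proof (rule psd_onI)
    show "0 \<le> quad I N x" for x
      unfolding N_def quad_add quad_scale quad_identity [OF fin] using coercive [of x] by simp
  qed (use symP in \<open>auto simp: N_def\<close>)
  have "\<delta> * (\<Sum>p\<in>I. C (a, p) (a, p)) \<le> choi_map I C P a a" if a: "a \<in> J" for a
  proof -
    have "psd_on (Pair a ` I) C"
      by (rule psd_on_subset [OF _ _ psd]) (use fin fJ a in auto)
    then have "psd_on I (\<lambda>p q. C (a, p) (a, q))"
      by (subst (asm) psd_on_reindex) (auto intro: inj_onI)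
    from psd_on_pairing_nonneg [OF fin this \<open>psd_on I N\<close>]
    have "0 \<le> (\<Sum>p\<in>I. \<Sum>q\<in>I. C (a, p) (a, q) * N p q)" .
    also have "\<dots> = (\<Sum>p\<in>I. \<Sum>q\<in>I. C (a, p) (a, q) * P p q)
        - (\<Sum>p\<in>I. \<Sum>q\<in>I. if p = q then \<delta> * C (a, p) (a, p) else 0)"
      unfolding sum_subtractf [symmetric] by (intro sum.cong refl) (auto simp: N_def algebra_simps)
    also have "\<dots> = choi_map I C P a a - \<delta> * (\<Sum>p\<in>I. C (a, p) (a, p))"
      using fin by (simp add: choi_map_def sum_distrib_left)
    finally show ?thesis by simp
  qed
  then have "(\<Sum>a\<in>J. \<delta> * (\<Sum>p\<in>I. C (a, p) (a, p))) \<le> (\<Sum>a\<in>J. choi_map I C P a a)"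
    by (rule sum_mono)
  then show ?thesis by (simp add: sum_Times sum_distrib_left)
qed

text \<open>Complete positivity of \<open>A\<^sub>k \<mapsto> B\<^sub>k\<close> is applied to the residual \<open>D\<close> between \<open>(B\<^sub>k)\<^sub>k\<close> and
  the nearest tuple of the form \<open>(\<Phi>\<^sub>C(A\<^sub>k))\<^sub>k\<close>: it forces \<open>\<Sum>\<^sub>k \<langle>D\<^sub>k, B\<^sub>k\<rangle> \<ge> 0\<close>, whereas optimality
  bounds this sum by \<open>- \<parallel>D\<parallel>\<^sup>2\<close>.\<close>
lemma completely_positive_choi_matrix:
  fixes A :: "'k :: finite \<Rightarrow> 'i \<Rightarrow> 'i \<Rightarrow> real" and B :: "'k \<Rightarrow> 'j \<Rightarrow> 'j \<Rightarrow> real"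
  assumes fin: "finite I" "finite J"
    and symA: "\<And>k p q. p \<in> I \<Longrightarrow> q \<in> I \<Longrightarrow> A k p q = A k q p"
    and symB: "\<And>k a b. a \<in> J \<Longrightarrow> b \<in> J \<Longrightarrow> B k a b = B k b a"
    and pd: "\<And>x. (\<exists>p\<in>I. x p \<noteq> 0) \<Longrightarrow> 0 < quad I (\<lambda>p q. \<Sum>k\<in>UNIV. c k * A k p q) x"
    and cp: "\<And>D :: 'k \<Rightarrow> 'j \<Rightarrow> 'j \<Rightarrow> real. (\<And>k a b. a \<in> J \<Longrightarrow> b \<in> J \<Longrightarrow> D k a b = D k b a) \<Longrightarrow>
      psd_on (J \<times> I) (kron_sum D A) \<Longrightarrow> psd_on (J \<times> J) (kron_sum D B)"
  shows "\<exists>C. psd_on (J \<times> I) C \<and> (\<forall>k. \<forall>a\<in>J. \<forall>b\<in>J. B k a b = choi_map I C (A k) a b)"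
proof -
  define P where "P p q = (\<Sum>k\<in>UNIV. c k * A k p q)" for p q
  have symP: "P p q = P q p" if "p \<in> I" "q \<in> I" for p q
    unfolding P_def using symA that by (intro sum.cong) auto
  have "0 < quad I P x" if "\<exists>p\<in>I. x p \<noteq> 0" for x
    using pd [OF that] by (simp add: P_def [abs_def])
  then obtain \<delta> where \<delta>: "0 < \<delta>" "\<And>x. \<delta> * (\<Sum>p\<in>I. (x p)\<^sup>2) \<le> quad I P x"
    using pd_on_coercive [OF fin(1), of P] by blast
  define X where "X = (UNIV :: 'k set) \<times> J \<times> J"
  have finX: "finite X" using fin by (simp add: X_def)
  define \<Phi> :: "('j \<times> 'i \<Rightarrow> 'j \<times> 'i \<Rightarrow> real) \<Rightarrow> 'k \<times> 'j \<times> 'j \<Rightarrow> real"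
    where "\<Phi> C u = (case u of (k, a, b) \<Rightarrow> choi_map I C (A k) a b)" for C u
  define b :: "'k \<times> 'j \<times> 'j \<Rightarrow> real" where "b u = (case u of (k, a, b) \<Rightarrow> B k a b)" for u
  define f where "f C = (\<Sum>u\<in>X. (\<Phi> C u - b u)\<^sup>2)" for C
  \<comment> \<open>Only Choi matrices at least as good as \<open>0\<close> matter, and \<open>R\<close> bounds their entries.\<close>
  define \<beta> where "\<beta> = f (\<lambda>u v. 0)"
  define R where "R = (\<Sum>a\<in>J. \<Sum>k\<in>UNIV. \<bar>c k\<bar> * (\<bar>B k a a\<bar> + sqrt \<beta>)) / \<delta>"
  have \<beta>0: "0 \<le> \<beta>" unfolding \<beta>_def f_def by (simp add: sum_nonneg)
  have R0: "0 \<le> R" unfolding R_def using \<delta>(1) \<beta>0 by (intro divide_nonneg_pos sum_nonneg) auto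
  have bound: "\<bar>C u v\<bar> \<le> R"
    if C: "psd_on (J \<times> I) C" and fC: "f C \<le> \<beta>" and uv: "u \<in> J \<times> I" "v \<in> J \<times> I" for C u v
  proof -
    have entry: "\<bar>choi_map I C (A k) a a\<bar> \<le> \<bar>B k a a\<bar> + sqrt \<beta>" if a: "a \<in> J" for k a
    proof -
      have "(\<Phi> C (k, a, a) - b (k, a, a))\<^sup>2 \<le> f C"
        unfolding f_def by (rule member_le_sum) (use finX a in \<open>auto simp: X_def\<close>)
      then have "\<bar>choi_map I C (A k) a a - B k a a\<bar> \<le> sqrt \<beta>"
        using fC by (intro real_le_rsqrt) (simp add: \<Phi>_def b_def)
      then show ?thesis by linarith
    qed
    have "choi_map I C P a a \<le> (\<Sum>k\<in>UNIV. \<bar>c k\<bar> * (\<bar>B k a a\<bar> + sqrt \<beta>))" if a: "a \<in> J" for a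
    proof -
      have "choi_map I C P a a = (\<Sum>k\<in>UNIV. c k * choi_map I C (A k) a a)"
        unfolding choi_map_linear P_def [abs_def] ..
      also have "\<dots> \<le> (\<Sum>k\<in>UNIV. \<bar>c k\<bar> * \<bar>choi_map I C (A k) a a\<bar>)"
        by (rule sum_mono) (metis abs_ge_self abs_mult)
      also have "\<dots> \<le> (\<Sum>k\<in>UNIV. \<bar>c k\<bar> * (\<bar>B k a a\<bar> + sqrt \<beta>))"
        by (intro sum_mono mult_left_mono entry a) simp
      finally show ?thesis .
    qed
    then have "(\<Sum>a\<in>J. choi_map I C P a a) \<le> R * \<delta>"
      using \<delta>(1) by (simp add: R_def sum_mono)
    moreover have "\<delta> * (\<Sum>u\<in>J \<times> I. C u u) \<le> (\<Sum>a\<in>J. choi_map I C P a a)"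
      by (rule choi_trace_bound [OF fin(1) C symP \<delta>(2) fin(2)])
    ultimately have "\<delta> * (\<Sum>u\<in>J \<times> I. C u u) \<le> \<delta> * R" by (simp add: mult.commute)
    then have "(\<Sum>u\<in>J \<times> I. C u u) \<le> R" using \<delta>(1) by simp
    then show ?thesis
      using psd_on_entry_le_trace [OF _ C uv] fin by simp
  qed
  define S where "S = {C. \<forall>u. C u \<in> {r. \<forall>v. r v \<in> {-R..R}}} \<inter> {C. psd_on (J \<times> I) C}"
  have contC: "continuous_on T (\<lambda>C :: 'j \<times> 'i \<Rightarrow> 'j \<times> 'i \<Rightarrow> real. C u v)" for u v T
  proof -
    have "continuous_on UNIV (\<lambda>C :: 'j \<times> 'i \<Rightarrow> 'j \<times> 'i \<Rightarrow> real. C u v)"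
      by (rule continuous_on_product_then_coordinatewise [OF continuous_on_product_coordinates])
    then show ?thesis by (rule continuous_on_subset) auto
  qed
  have closed_psd: "closed {C. psd_on (J \<times> I) C}"
  proof -
    have "{C. psd_on (J \<times> I) C} = (\<Inter>u\<in>J \<times> I. \<Inter>v\<in>J \<times> I. {C. C u v = C v u}) \<inter> (\<Inter>x. {C. 0 \<le> quad (J \<times> I) C x})"
      by (auto simp: psd_on_def)
    also have "closed \<dots>"
      by (intro closed_Int closed_INT ballI closed_Collect_eq closed_Collect_le contC
        continuous_on_quad continuous_on_const)
    finally show ?thesis .
  qed
  have "compact S"
    unfolding S_def by (intro compact_Int_closed compact_function_box closed_psd compact_Icc)
  moreover have "(\<lambda>u v. 0) \<in> S" using R0 by (simp add: S_def psd_on_zero)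
  moreover have "continuous_on S f"
    unfolding f_def \<Phi>_def choi_map_def
    by (intro continuous_intros) (auto split: prod.split intro!: continuous_intros contC)
  ultimately obtain C0 where C0: "C0 \<in> S" "\<And>C. C \<in> S \<Longrightarrow> f C0 \<le> f C"
    using continuous_attains_inf [of S f] by blast
  have psd0: "psd_on (J \<times> I) C0" using C0(1) by (simp add: S_def)
  \<comment> \<open>Setting the entries of \<open>C\<close> outside the index set to zero moves \<open>C\<close> into the compact set and
    leaves \<open>f C\<close> unchanged.\<close>
  have minimal: "f C0 \<le> f C" if C: "psd_on (J \<times> I) C" for C
  proof (cases "f C \<le> \<beta>")
    case True
    define C' where "C' u v = (if u \<in> J \<times> I \<and> v \<in> J \<times> I then C u v else 0)" for u v
    have "psd_on (J \<times> I) C'"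
      using C by (subst psd_on_cong [of _ C' C]) (auto simp: C'_def)
    moreover have "\<bar>C' u v\<bar> \<le> R" for u v
      using bound [OF C True] R0 by (simp add: C'_def)
    then have "- R \<le> C' u v \<and> C' u v \<le> R" for u v by (meson abs_le_iff minus_le_iff)
    ultimately have "C' \<in> S" by (simp add: S_def)
    then have "f C0 \<le> f C'" by (rule C0)
    also have "f C' = f C"
      unfolding f_def
      by (intro sum.cong refl)
        (auto simp: \<Phi>_def X_def C'_def intro!: arg_cong [where f = "\<lambda>r. (r - b _)\<^sup>2"] choi_map_cong [where J = J])
    finally show ?thesis .
  next
    case False
    have "f C0 \<le> \<beta>" unfolding \<beta>_def by (rule C0) fact
    then show ?thesis using False by simp
  qed
  define K where "K = {\<Phi> C | C. psd_on (J \<times> I) C}"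
  define D where "D k a b' = choi_map I C0 (A k) a b' - B k a b'" for k a b'
  have KI: "\<Phi> C \<in> K" if "psd_on (J \<times> I) C" for C using that by (auto simp: K_def)
  have Kadd: "(\<lambda>u. v u + w u) \<in> K" if vw: "v \<in> K" "w \<in> K" for v w
  proof -
    obtain C C' where C: "psd_on (J \<times> I) C" "v = \<Phi> C" "psd_on (J \<times> I) C'" "w = \<Phi> C'"
      using vw by (auto simp: K_def)
    have "(\<lambda>u. v u + w u) = \<Phi> (\<lambda>u v. C u v + C' u v)"
      unfolding C by (rule ext) (auto simp: \<Phi>_def choi_map_add split: prod.split)
    then show ?thesis using KI [OF psd_on_add [OF C(1,3)]] by simp
  qed
  have Kscale: "(\<lambda>u. t * v u) \<in> K" if v: "v \<in> K" and t: "0 \<le> t" for v t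
  proof -
    obtain C where C: "psd_on (J \<times> I) C" "v = \<Phi> C" using v by (auto simp: K_def)
    have "(\<lambda>u. t * v u) = \<Phi> (\<lambda>u v. t * C u v)"
      unfolding C by (rule ext) (auto simp: \<Phi>_def choi_map_scale split: prod.split)
    then show ?thesis using KI [OF psd_on_scale [OF C(1) t]] by simp
  qed
  have nearest: "(\<Sum>u\<in>X. (\<Phi> C0 u - b u)\<^sup>2) \<le> (\<Sum>u\<in>X. (w u - b u)\<^sup>2)" if "w \<in> K" for w
    using that minimal by (auto simp: K_def f_def)
  have cone: "0 \<le> (\<Sum>u\<in>X. (\<Phi> C0 u - b u) * w u)" if "w \<in> K" for w
    using Kadd Kscale KI [OF psd0] nearest that by (rule nearest_point_of_cone(1))
  have apex: "(\<Sum>u\<in>X. (\<Phi> C0 u - b u) * \<Phi> C0 u) \<le> 0"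
    using Kadd Kscale KI [OF psd0] nearest by (rule nearest_point_of_cone(2))
  have X_sum: "(\<Sum>u\<in>X. g u) = (\<Sum>k\<in>UNIV. \<Sum>a\<in>J. \<Sum>b\<in>J. g (k, a, b))" for g :: "_ \<Rightarrow> real"
    by (simp add: X_def sum_Times)
  have symD: "D k a b' = D k b' a" if "a \<in> J" "b' \<in> J" for k a b'
    unfolding D_def using symB [OF that] choi_map_sym [OF psd0 symA that] by simp
  have "psd_on (J \<times> I) (kron_sum D A)"
  proof (rule psd_onI)
    fix x :: "'j \<times> 'i \<Rightarrow> real"
    \<comment> \<open>The form of the tensor at \<open>x\<close> is its pairing with the rank-one matrix of \<open>x\<close>.\<close>
    have "psd_on (J \<times> I) (\<lambda>u v. x u * x v)"
    proof (rule psd_onI)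
      fix y
      have "quad (J \<times> I) (\<lambda>u v. x u * x v) y = (\<Sum>u\<in>J \<times> I. x u * y u)\<^sup>2"
        by (simp add: quad_def sum_product power2_eq_square mult_ac)
      then show "0 \<le> quad (J \<times> I) (\<lambda>u v. x u * x v) y" by simp
    qed simp
    then have "\<Phi> (\<lambda>u v. x u * x v) \<in> K" by (rule KI)
    then have "0 \<le> (\<Sum>u\<in>X. (\<Phi> C0 u - b u) * \<Phi> (\<lambda>u v. x u * x v) u)" by (rule cone)
    then have "0 \<le> (\<Sum>k\<in>UNIV. \<Sum>a\<in>J. \<Sum>b\<in>J. D k a b * choi_map I (\<lambda>u v. x u * x v) (A k) a b)"
      by (simp add: X_sum \<Phi>_def b_def D_def)
    then show "0 \<le> quad (J \<times> I) (kron_sum D A) x"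
      by (simp add: choi_map_pairing quad_def mult_ac)
  next
    show "kron_sum D A u v = kron_sum D A v u" if "u \<in> J \<times> I" "v \<in> J \<times> I" for u v
      unfolding kron_sum_def using that symA symD by (intro sum.cong refl) (metis mem_Times_iff)
  qed
  with symD have "psd_on (J \<times> J) (kron_sum D B)" by (intro cp) auto
  \<comment> \<open>Evaluate at the identity matrix, read as a vector.\<close>
  then have "0 \<le> quad (J \<times> J) (kron_sum D B) (\<lambda>u. if fst u = snd u then 1 else 0)"
    by (rule psd_on_quad)
  also have "\<dots> = (\<Sum>a\<in>J. \<Sum>b\<in>J. kron_sum D B (a, a) (b, b))"
  proof -
    have "quad (J \<times> J) (kron_sum D B) (\<lambda>u. if fst u = snd u then 1 else 0) =
      (\<Sum>a\<in>J. \<Sum>p\<in>J. if a = p then (\<Sum>b\<in>J. \<Sum>q\<in>J. if b = q then kron_sum D B (a, a) (b, b) else 0) else 0)"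
      unfolding quad_def sum_Times by (intro sum.cong refl) (auto intro!: sum.cong)
    then show ?thesis using fin by simp
  qed
  also have "\<dots> = (\<Sum>k\<in>UNIV. \<Sum>a\<in>J. \<Sum>b\<in>J. D k a b * B k a b)"
    by (subst sum_rotate3) (simp add: kron_sum_def)
  also have "\<dots> = (\<Sum>u\<in>X. (\<Phi> C0 u - b u) * b u)"
    by (simp add: X_sum \<Phi>_def b_def D_def)
  also have "\<dots> = (\<Sum>u\<in>X. (\<Phi> C0 u - b u) * \<Phi> C0 u) - (\<Sum>u\<in>X. (\<Phi> C0 u - b u)\<^sup>2)"
    unfolding sum_subtractf [symmetric] by (intro sum.cong) (auto simp: power2_eq_square algebra_simps)
  finally have "(\<Sum>u\<in>X. (\<Phi> C0 u - b u)\<^sup>2) \<le> 0"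
    using apex by simp
  then have "(\<Sum>u\<in>X. (\<Phi> C0 u - b u)\<^sup>2) = 0" by (intro antisym sum_nonneg) auto
  then have "\<forall>u\<in>X. \<Phi> C0 u = b u" using finX by (simp add: sum_nonneg_eq_0_iff)
  then have "B k a b' = choi_map I C0 (A k) a b'" if "a \<in> J" "b' \<in> J" for k a b'
    using that by (force simp: X_def \<Phi>_def b_def)
  then show ?thesis using psd0 by blast
qed

section \<open>Congruences and homogeneous tuples\<close>

lemma psd_on_congruence:
  assumes psd: "psd_on I M"
  shows "psd_on J (\<lambda>a b. \<Sum>p\<in>I. \<Sum>q\<in>I. T a p * T b q * M p q)"
proof (rule psd_onI)
  fix x
  have "quad J (\<lambda>a b. \<Sum>p\<in>I. \<Sum>q\<in>I. T a p * T b q * M p q) x =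
      (\<Sum>a\<in>J. \<Sum>b\<in>J. \<Sum>p\<in>I. \<Sum>q\<in>I. (x a * T a p) * M p q * (x b * T b q))"
    by (simp add: quad_def sum_distrib_left sum_distrib_right mult_ac)
  also have "\<dots> = (\<Sum>p\<in>I. \<Sum>q\<in>I. \<Sum>a\<in>J. \<Sum>b\<in>J. (x a * T a p) * M p q * (x b * T b q))"
    by (simp add: sum.swap [where A = J and B = I])
  also have "\<dots> = quad I M (\<lambda>p. \<Sum>a\<in>J. x a * T a p)"
    by (simp add: quad_def sum_distrib_left sum_distrib_right mult_ac)
  finally show "0 \<le> quad J (\<lambda>a b. \<Sum>p\<in>I. \<Sum>q\<in>I. T a p * T b q * M p q) x"
    using psd_on_quad [OF psd] by simp
next
  fix a b
  have "(\<Sum>p\<in>I. \<Sum>q\<in>I. T a p * T b q * M p q) = (\<Sum>q\<in>I. \<Sum>p\<in>I. T a p * T b q * M p q)"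
    by (rule sum.swap)
  also have "\<dots> = (\<Sum>q\<in>I. \<Sum>p\<in>I. T b q * T a p * M q p)"
    using psd_on_sym [OF psd] by (intro sum.cong refl) (simp add: mult_ac)
  finally show "(\<Sum>p\<in>I. \<Sum>q\<in>I. T a p * T b q * M p q) = (\<Sum>p\<in>I. \<Sum>q\<in>I. T b p * T a q * M p q)" .
qed

text \<open>The congruence with \<open>G \<otimes> I\<close>, which renormalises the tuple \<open>Z\<close>.\<close>
lemma psd_on_kron_congruence_left:
  fixes A :: "'k :: finite \<Rightarrow> 'i \<Rightarrow> 'i \<Rightarrow> real"
  assumes fin: "finite I" and psd: "psd_on (D \<times> I) (kron_sum Z A)"
  shows "psd_on (E \<times> I) (kron_sum (\<lambda>k s t. \<Sum>u\<in>D. \<Sum>w\<in>D. G s u * G t w * Z k u w) A)"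
proof -
  define T where "T a u = (if snd a = snd u then G (fst a) (fst u) else 0)" for a u :: "_ \<times> 'i"
  have "(\<Sum>x\<in>D \<times> I. \<Sum>y\<in>D \<times> I. T a x * T b y * kron_sum Z A x y) =
    kron_sum (\<lambda>k s t. \<Sum>u\<in>D. \<Sum>w\<in>D. G s u * G t w * Z k u w) A a b"
    if ab: "a \<in> E \<times> I" "b \<in> E \<times> I" for a b
  proof -
    obtain s p t q where st: "a = (s, p)" "b = (t, q)" and pq: "p \<in> I" "q \<in> I" using ab by auto
    have "(\<Sum>x\<in>D \<times> I. \<Sum>y\<in>D \<times> I. T a x * T b y * kron_sum Z A x y) =
        (\<Sum>u\<in>D. \<Sum>p'\<in>I. if p = p' then (\<Sum>w\<in>D. \<Sum>q'\<in>I. if q = q'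
          then G s u * G t w * kron_sum Z A (u, p) (w, q) else 0) else 0)"
      unfolding sum_Times by (intro sum.cong refl) (auto simp: T_def st intro!: sum.cong)
    also have "\<dots> = (\<Sum>u\<in>D. \<Sum>w\<in>D. G s u * G t w * kron_sum Z A (u, p) (w, q))"
      using fin pq by simp
    also have "\<dots> = (\<Sum>u\<in>D. \<Sum>w\<in>D. \<Sum>k\<in>UNIV. G s u * G t w * Z k u w * A k p q)"
      by (simp add: kron_sum_def sum_distrib_left mult_ac)
    also have "\<dots> = (\<Sum>k\<in>UNIV. \<Sum>u\<in>D. \<Sum>w\<in>D. G s u * G t w * Z k u w * A k p q)"
      by (rule sum_rotate3 [symmetric])
    also have "\<dots> = kron_sum (\<lambda>k s t. \<Sum>u\<in>D. \<Sum>w\<in>D. G s u * G t w * Z k u w) A a b"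
      by (simp add: kron_sum_def st sum_distrib_right)
    finally show ?thesis .
  qed
  then show ?thesis
    using psd_on_congruence [OF psd, of "E \<times> I" T] psd_on_cong by (metis (no_types, lifting))
qed

text \<open>The congruence with \<open>I \<otimes> V\<close>, which compresses the coefficients \<open>A\<^sub>k\<close>.\<close>
lemma psd_on_kron_congruence_right:
  fixes A :: "'k :: finite \<Rightarrow> 'i \<Rightarrow> 'i \<Rightarrow> real" and Z :: "'k \<Rightarrow> 's \<Rightarrow> 's \<Rightarrow> real"
    and V :: "'j \<Rightarrow> 'i \<Rightarrow> real"
  assumes fin: "finite D" and psd: "psd_on (D \<times> I) (kron_sum Z A)"
  shows "psd_on (D \<times> J) (kron_sum Z (\<lambda>k a b. \<Sum>p\<in>I. \<Sum>q\<in>I. V a p * V b q * A k p q))"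
proof -
  define T where "T a u = (if fst a = fst u then V (snd a) (snd u) else 0)" for a :: "'s \<times> 'j" and u :: "'s \<times> 'i"
  have "(\<Sum>x\<in>D \<times> I. \<Sum>y\<in>D \<times> I. T a x * T b y * kron_sum Z A x y) =
    kron_sum Z (\<lambda>k a b. \<Sum>p\<in>I. \<Sum>q\<in>I. V a p * V b q * A k p q) a b"
    if ab: "a \<in> D \<times> J" "b \<in> D \<times> J" for a b
  proof -
    obtain s a' t b' where st: "a = (s, a')" "b = (t, b')" and D: "s \<in> D" "t \<in> D" using ab by auto
    have "(\<Sum>x\<in>D \<times> I. \<Sum>y\<in>D \<times> I. T a x * T b y * kron_sum Z A x y) =
        (\<Sum>s'\<in>D. if s = s' then (\<Sum>p\<in>I. \<Sum>t'\<in>D. if t = t' then (\<Sum>q\<in>I.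
          V a' p * V b' q * kron_sum Z A (s, p) (t, q)) else 0) else 0)"
      unfolding sum_Times by (intro sum.cong refl) (auto simp: T_def st intro!: sum.cong)
    also have "\<dots> = (\<Sum>p\<in>I. \<Sum>q\<in>I. V a' p * V b' q * kron_sum Z A (s, p) (t, q))"
      using fin D by simp
    also have "\<dots> = (\<Sum>p\<in>I. \<Sum>q\<in>I. \<Sum>k\<in>UNIV. Z k s t * (V a' p * V b' q * A k p q))"
      by (simp add: kron_sum_def sum_distrib_left mult_ac)
    also have "\<dots> = (\<Sum>k\<in>UNIV. \<Sum>p\<in>I. \<Sum>q\<in>I. Z k s t * (V a' p * V b' q * A k p q))"
      by (rule sum_rotate3 [symmetric])
    also have "\<dots> = kron_sum Z (\<lambda>k a b. \<Sum>p\<in>I. \<Sum>q\<in>I. V a p * V b q * A k p q) a b"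
      by (simp add: kron_sum_def st sum_distrib_left)
    finally show ?thesis .
  qed
  then show ?thesis
    using psd_on_congruence [OF psd, of "D \<times> J" T] psd_on_cong by (metis (no_types, lifting))
qed

text \<open>The Gram factor of a definite matrix is square, and a kernel vector of its transpose would be
  isotropic; so the factor has a nonzero determinant and a two-sided inverse.\<close>
lemma pd_on_gram_invertible:
  fixes Z :: "nat \<Rightarrow> nat \<Rightarrow> real" and d :: nat
  defines "D \<equiv> {..<d}"
  assumes psd: "psd_on D Z" and pd: "\<And>x. (\<exists>s\<in>D. x s \<noteq> 0) \<Longrightarrow> 0 < quad D Z x"
  shows "\<exists>F G. (\<forall>s\<in>D. \<forall>t\<in>D. Z s t = (\<Sum>r\<in>D. F s r * F t r)) \<and>
    (\<forall>s\<in>D. \<forall>t\<in>D. (\<Sum>r\<in>D. F s r * G r t) = (if s = t then 1 else 0)) \<and>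
    (\<forall>s\<in>D. \<forall>t\<in>D. (\<Sum>r\<in>D. G s r * F r t) = (if s = t then 1 else 0))"
proof -
  obtain F where F: "\<And>s t. s \<in> D \<Longrightarrow> t \<in> D \<Longrightarrow> Z s t = (\<Sum>r\<in>D. F s r * F t r)"
    using psd_on_gram [OF _ psd] by (auto simp: D_def)
  define M where "M = mat d d (\<lambda>(r, s). F s r)"
  have M: "M \<in> carrier_mat d d" by (simp add: M_def)
  have "det M \<noteq> 0"
  proof
    assume "det M = 0"
    then obtain v where v: "v \<in> carrier_vec d" "v \<noteq> 0\<^sub>v d" "M *\<^sub>v v = 0\<^sub>v d"
      using det_0_iff_vec_prod_zero_field [OF M] by blast
    define x where "x s = vec_index v s" for s
    have "\<exists>s\<in>D. x s \<noteq> 0"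
    proof (rule ccontr)
      assume "\<not> ?thesis"
      then have "v = 0\<^sub>v d" using v(1) by (intro eq_vecI) (auto simp: x_def D_def)
      then show False using v(2) by simp
    qed
    then have "0 < quad D Z x" by (rule pd)
    moreover have Mv: "(\<Sum>s\<in>D. x s * F s r) = 0" if "r \<in> D" for r
    proof -
      have "vec_index (M *\<^sub>v v) r = 0" using v(3) that by (simp add: D_def)
      then show ?thesis using that v(1)
        by (simp add: M_def D_def scalar_prod_def x_def atLeast0LessThan mult.commute)
    qed
    have "quad D Z x = (\<Sum>s\<in>D. \<Sum>t\<in>D. \<Sum>r\<in>D. (x s * F s r) * (x t * F t r))"
      unfolding quad_def
      by (intro sum.cong refl) (simp add: F sum_distrib_left sum_distrib_right mult_ac)
    also have "\<dots> = (\<Sum>r\<in>D. \<Sum>s\<in>D. \<Sum>t\<in>D. (x s * F s r) * (x t * F t r))"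
      by (rule sum_rotate3 [symmetric])
    also have "\<dots> = 0" by (simp add: Mv flip: sum_product)
    ultimately show False by simp
  qed
  from det_non_zero_imp_unit [OF M this, of "()"]
  obtain N where N: "N \<in> carrier_mat d d" "N * M = 1\<^sub>m d" "M * N = 1\<^sub>m d"
    by (auto simp: Units_def ring_mat_def)
  define G where "G s r = N $$ (r, s)" for r s
  have FG: "(\<Sum>r\<in>D. F s r * G r t) = (if s = t then 1 else 0)" if "s \<in> D" "t \<in> D" for s t
  proof -
    have "(N * M) $$ (t, s) = (\<Sum>r\<in>D. F s r * G r t)"
      using that N(1) M
      by (simp add: D_def scalar_prod_def M_def G_def atLeast0LessThan mult.commute)
    then show ?thesis using that unfolding N(2) by (auto simp: D_def)
  qed
  have GF: "(\<Sum>r\<in>D. G s r * F r t) = (if s = t then 1 else 0)" if "s \<in> D" "t \<in> D" for s t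
  proof -
    have "(M * N) $$ (t, s) = (\<Sum>r\<in>D. G s r * F r t)"
      using that N(1) M
      by (simp add: D_def scalar_prod_def M_def G_def atLeast0LessThan mult.commute)
    then show ?thesis using that unfolding N(3) by (auto simp: D_def)
  qed
  show ?thesis using F FG GF by blast
qed

lemma congruence_compose:
  fixes Z :: "'d \<Rightarrow> 'd \<Rightarrow> real"
  shows "(\<Sum>u\<in>D. \<Sum>w\<in>D. F s u * F t w * (\<Sum>x\<in>D. \<Sum>y\<in>D. G u x * G w y * Z x y)) =
    (\<Sum>x\<in>D. \<Sum>y\<in>D. (\<Sum>u\<in>D. F s u * G u x) * (\<Sum>w\<in>D. F t w * G w y) * Z x y)"
proof -
  have "(\<Sum>u\<in>D. \<Sum>w\<in>D. F s u * F t w * (\<Sum>x\<in>D. \<Sum>y\<in>D. G u x * G w y * Z x y)) =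
      (\<Sum>u\<in>D. \<Sum>w\<in>D. \<Sum>x\<in>D. \<Sum>y\<in>D. (F s u * G u x) * (F t w * G w y) * Z x y)"
    by (simp add: sum_distrib_left mult_ac)
  also have "\<dots> = (\<Sum>u\<in>D. \<Sum>x\<in>D. \<Sum>y\<in>D. \<Sum>w\<in>D. (F s u * G u x) * (F t w * G w y) * Z x y)"
    by (rule sum.cong [OF refl], rule sum_rotate3)
  also have "\<dots> = (\<Sum>x\<in>D. \<Sum>y\<in>D. \<Sum>u\<in>D. \<Sum>w\<in>D. (F s u * G u x) * (F t w * G w y) * Z x y)"
    by (rule sum_rotate3)
  also have "\<dots> = (\<Sum>x\<in>D. \<Sum>y\<in>D. (\<Sum>u\<in>D. F s u * G u x) * (\<Sum>w\<in>D. F t w * G w y) * Z x y)"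
    by (simp add: sum_product flip: sum_distrib_right)
  finally show ?thesis .
qed

lemma congruence_inverse:
  fixes Z :: "'d \<Rightarrow> 'd \<Rightarrow> real"
  assumes fin: "finite D" and st: "s \<in> D" "t \<in> D"
    and FG: "\<And>s t. s \<in> D \<Longrightarrow> t \<in> D \<Longrightarrow> (\<Sum>r\<in>D. F s r * G r t) = (if s = t then 1 else 0)"
  shows "(\<Sum>u\<in>D. \<Sum>w\<in>D. F s u * F t w * (\<Sum>x\<in>D. \<Sum>y\<in>D. G u x * G w y * Z x y)) = Z s t"
proof -
  have "(\<Sum>x\<in>D. \<Sum>y\<in>D. (\<Sum>u\<in>D. F s u * G u x) * (\<Sum>w\<in>D. F t w * G w y) * Z x y) =
    (\<Sum>x\<in>D. if s = x then (\<Sum>y\<in>D. if t = y then Z s t else 0) else 0)"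
    using st by (intro sum.cong refl) (auto simp: FG intro!: sum.cong)
  then show ?thesis unfolding congruence_compose using fin st by simp
qed

lemma psd_on_if_perturbed:
  assumes sym: "\<And>i j. i \<in> I \<Longrightarrow> j \<in> I \<Longrightarrow> M i j = M j i"
    and psd: "\<And>\<epsilon>. 0 < \<epsilon> \<Longrightarrow> psd_on I (\<lambda>i j. M i j + \<epsilon> * N i j)"
  shows "psd_on I M"
proof (rule psd_onI)
  fix x
  show "0 \<le> quad I M x"
  proof (rule field_le_epsilon)
    fix e :: real assume e: "0 < e"
    let ?\<epsilon> = "e / (\<bar>quad I N x\<bar> + 1)"
    have "0 \<le> quad I M x + ?\<epsilon> * quad I N x"
      using psd_on_quad [OF psd, of ?\<epsilon> x] e unfolding quad_add quad_scale by simp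
    also have "?\<epsilon> * quad I N x \<le> ?\<epsilon> * (\<bar>quad I N x\<bar> + 1)"
      using e by (intro mult_left_mono) auto
    also have "\<dots> = e" by simp
    finally show "0 \<le> quad I M x + e" by simp
  qed
qed (use sym in auto)

text \<open>Positivity of \<open>\<Sum>\<^sub>k Z\<^sub>k \<otimes> A\<^sub>k\<close> only has to be transferred when \<open>Z\<^sub>h\<close> is the identity matrix,
  where \<open>h\<close> is a distinguished index. If \<open>Z\<^sub>h = F F\<^sup>*\<close> is definite, the congruence by
  \<open>F\<^sup>-\<^sup>1\<close> turns \<open>Z\<^sub>h\<close> into the identity and is undone after the transfer. In
  general \<open>Z\<^sub>h\<close> is semidefinite, because evaluating the tensor at product vectors gives
  positive semidefinite combinations of the \<open>A\<^sub>k\<close>, whose coefficient at \<open>h\<close> is nonnegative by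
  assumption. Adding \<open>\<epsilon> I\<close> to \<open>Z\<^sub>h\<close> makes it definite and keeps the tensor positive, since
  \<open>A\<^sub>h\<close> is positive semidefinite; then \<open>\<epsilon>\<close> tends to zero.\<close>
lemma completely_positive_if_monic_inclusion:
  fixes A :: "'k :: finite \<Rightarrow> 'i \<Rightarrow> 'i \<Rightarrow> real" and B :: "'k \<Rightarrow> 'j \<Rightarrow> 'j \<Rightarrow> real"
    and Z :: "'k \<Rightarrow> nat \<Rightarrow> nat \<Rightarrow> real" and d :: nat
  defines "D \<equiv> {..<d}"
  assumes fin: "finite I" "finite J"
    and symB: "\<And>k a b. a \<in> J \<Longrightarrow> b \<in> J \<Longrightarrow> B k a b = B k b a"
    and A0: "psd_on I (A h)"
    and nonneg: "\<And>c. psd_on I (\<lambda>p q. \<Sum>k\<in>UNIV. c k * A k p q) \<Longrightarrow> 0 \<le> c h"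
    and incl: "\<And>Z. (\<And>k s t. s \<in> D \<Longrightarrow> t \<in> D \<Longrightarrow> Z k s t = Z k t s) \<Longrightarrow>
      (\<And>s t. s \<in> D \<Longrightarrow> t \<in> D \<Longrightarrow> Z h s t = (if s = t then 1 else 0)) \<Longrightarrow>
      psd_on (D \<times> I) (kron_sum Z A) \<Longrightarrow> psd_on (D \<times> J) (kron_sum Z B)"
    and symZ: "\<And>k s t. s \<in> D \<Longrightarrow> t \<in> D \<Longrightarrow> Z k s t = Z k t s"
    and psd: "psd_on (D \<times> I) (kron_sum Z A)"
  shows "psd_on (D \<times> J) (kron_sum Z B)"
proof -
  have finD: "finite D" by (simp add: D_def)
  have definite: "psd_on (D \<times> J) (kron_sum Y B)"
    if symY: "\<And>k s t. s \<in> D \<Longrightarrow> t \<in> D \<Longrightarrow> Y k s t = Y k t s"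
      and psdY: "psd_on (D \<times> I) (kron_sum Y A)"
      and pdY: "\<And>x. (\<exists>s\<in>D. x s \<noteq> 0) \<Longrightarrow> 0 < quad D (Y h) x" for Y
  proof -
    have "0 \<le> quad D (Y h) x" for x
    proof (cases "\<exists>s\<in>D. x s \<noteq> 0")
      case True
      then show ?thesis using pdY by (simp add: less_imp_le)
    qed (simp add: quad_def)
    then have psdY0: "psd_on D (Y h)" using symY by (auto intro: psd_onI)
    obtain F G where F: "\<And>s t. s \<in> D \<Longrightarrow> t \<in> D \<Longrightarrow> Y h s t = (\<Sum>r\<in>D. F s r * F t r)"
      and FG: "\<And>s t. s \<in> D \<Longrightarrow> t \<in> D \<Longrightarrow> (\<Sum>r\<in>D. F s r * G r t) = (if s = t then 1 else 0)"
      and GF: "\<And>s t. s \<in> D \<Longrightarrow> t \<in> D \<Longrightarrow> (\<Sum>r\<in>D. G s r * F r t) = (if s = t then 1 else 0)"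
      using pd_on_gram_invertible [OF psdY0 [unfolded D_def] pdY [unfolded D_def]]
      unfolding D_def by blast
    define Y' where "Y' k s t = (\<Sum>u\<in>D. \<Sum>w\<in>D. G s u * G t w * Y k u w)" for k s t
    have "psd_on (D \<times> I) (kron_sum Y' A)"
      unfolding Y'_def [abs_def] by (rule psd_on_kron_congruence_left [OF fin(1) psdY])
    moreover have "Y' k s t = Y' k t s" for k s t
    proof -
      have "Y' k s t = (\<Sum>w\<in>D. \<Sum>u\<in>D. G s u * G t w * Y k u w)"
        unfolding Y'_def by (rule sum.swap)
      also have "\<dots> = Y' k t s"
        unfolding Y'_def using symY by (intro sum.cong refl) (simp add: mult_ac)
      finally show ?thesis .
    qed
    moreover have "Y' h s t = (if s = t then 1 else 0)" if st: "s \<in> D" "t \<in> D" for s t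
    proof -
      have "Y h u w = (\<Sum>x\<in>D. \<Sum>y\<in>D. F u x * F w y * (if x = y then 1 else 0))"
        if "u \<in> D" "w \<in> D" for u w
      proof -
        have "(\<Sum>x\<in>D. \<Sum>y\<in>D. F u x * F w y * (if x = y then 1 else 0)) =
          (\<Sum>x\<in>D. \<Sum>y\<in>D. if x = y then F u x * F w x else 0)"
          by (intro sum.cong refl) auto
        then show ?thesis using finD that by (simp add: F)
      qed
      then have "Y' h s t = (\<Sum>u\<in>D. \<Sum>w\<in>D. G s u * G t w *
          (\<Sum>x\<in>D. \<Sum>y\<in>D. F u x * F w y * (if x = y then 1 else 0)))"
        unfolding Y'_def by simp
      then show ?thesis by (simp only: congruence_inverse [OF finD st GF])
    qed
    ultimately have "psd_on (D \<times> J) (kron_sum Y' B)" by (intro incl)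
    from psd_on_kron_congruence_left [OF fin(2) this, of D F]
    show ?thesis
    proof (rule iffD1 [OF psd_on_cong, rotated])
      fix x y assume xy: "x \<in> D \<times> J" "y \<in> D \<times> J"
      then have "(\<Sum>u\<in>D. \<Sum>w\<in>D. F (fst x) u * F (fst y) w * Y' k u w) = Y k (fst x) (fst y)" for k
        unfolding Y'_def by (intro congruence_inverse [OF finD _ _ FG]) auto
      then show "kron_sum (\<lambda>k s t. \<Sum>u\<in>D. \<Sum>w\<in>D. F s u * F t w * Y' k u w) B x y = kron_sum Y B x y"
        by (simp add: kron_sum_def)
    qed
  qed
  \<comment> \<open>The form of \<open>Z h\<close> at \<open>x\<close> is the coefficient of \<open>A h\<close> in the compression of the tensor by
    the row vector \<open>x\<close>, here a matrix with the one-element row index set of type \<open>unit\<close>.\<close>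
  have Z0: "0 \<le> quad D (Z h) x" for x
  proof -
    define c where "c k = (\<Sum>u\<in>D. \<Sum>w\<in>D. x u * x w * Z k u w)" for k
    have "psd_on ({()} \<times> I) (kron_sum (\<lambda>k s t. c k) A)"
      unfolding c_def by (rule psd_on_kron_congruence_left [OF fin(1) psd])
    then have "psd_on (Pair () ` I) (kron_sum (\<lambda>k s t. c k) A)"
      by (rule psd_on_subset [rotated 2]) (use fin in auto)
    then have "psd_on I (\<lambda>p q. \<Sum>k\<in>UNIV. c k * A k p q)"
      by (subst (asm) psd_on_reindex) (auto simp: kron_sum_def intro: inj_onI)
    then have "0 \<le> c h" by (rule nonneg)
    then show ?thesis by (simp add: c_def quad_def mult_ac)
  qed
  define E where "E k s t = (if k = h \<and> s = t then 1 else 0 :: real)" for k and s t :: nat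
  have kron_E: "kron_sum (\<lambda>k s t. Z k s t + \<epsilon> * E k s t) M = (\<lambda>u v. kron_sum Z M u v + \<epsilon> * kron_sum E M u v)"
    for \<epsilon> and M :: "'k \<Rightarrow> 'l \<Rightarrow> 'l \<Rightarrow> real"
    by (intro ext) (simp add: kron_sum_def algebra_simps sum.distrib sum_distrib_left)
  have psdE: "psd_on (D \<times> I) (kron_sum E A)"
  proof (rule psd_onI)
    have E: "kron_sum E A (s, p) (t, q) = (if s = t then A h p q else 0)" for s t p q
    proof -
      have "kron_sum E A (s, p) (t, q) = (\<Sum>k\<in>UNIV. if k = h then (if s = t then A h p q else 0) else 0)"
        unfolding kron_sum_def by (rule sum.cong) (auto simp: E_def)
      then show ?thesis by simp
    qed
    show "kron_sum E A u v = kron_sum E A v u" if "u \<in> D \<times> I" "v \<in> D \<times> I" for u v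
      using that psd_on_sym [OF A0] by (auto simp: E)
    fix x :: "nat \<times> 'i \<Rightarrow> real"
    have "quad (D \<times> I) (kron_sum E A) x =
      (\<Sum>s\<in>D. \<Sum>p\<in>I. \<Sum>t\<in>D. if s = t then (\<Sum>q\<in>I. x (s, p) * A h p q * x (s, q)) else 0)"
      unfolding quad_def sum_Times E by (intro sum.cong refl) auto
    also have "\<dots> = (\<Sum>s\<in>D. quad I (A h) (\<lambda>p. x (s, p)))"
      using finD by (simp add: quad_def)
    finally show "0 \<le> quad (D \<times> I) (kron_sum E A) x"
      using psd_on_quad [OF A0] by (simp add: sum_nonneg)
  qed
  show ?thesis
  proof (rule psd_on_if_perturbed)
    show "kron_sum Z B u v = kron_sum Z B v u" if "u \<in> D \<times> J" "v \<in> D \<times> J" for u v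
      unfolding kron_sum_def using that symB symZ by (intro sum.cong refl) (metis mem_Times_iff)
    fix \<epsilon> :: real assume \<epsilon>: "0 < \<epsilon>"
    have "psd_on (D \<times> J) (kron_sum (\<lambda>k s t. Z k s t + \<epsilon> * E k s t) B)"
    proof (rule definite)
      show "Z k s t + \<epsilon> * E k s t = Z k t s + \<epsilon> * E k t s" if "s \<in> D" "t \<in> D" for k s t
        using symZ that by (auto simp: E_def)
      show "psd_on (D \<times> I) (kron_sum (\<lambda>k s t. Z k s t + \<epsilon> * E k s t) A)"
        unfolding kron_E using psd_on_add [OF psd psd_on_scale [OF psdE]] \<epsilon> by simp
      fix x :: "nat \<Rightarrow> real" assume x: "\<exists>s\<in>D. x s \<noteq> 0"
      have "E h = (\<lambda>s t. if s = t then 1 else 0)" by (intro ext) (simp add: E_def)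
      then have "quad D (\<lambda>s t. Z h s t + \<epsilon> * E h s t) x = quad D (Z h) x + \<epsilon> * (\<Sum>s\<in>D. (x s)\<^sup>2)"
        by (simp add: quad_add quad_scale quad_identity [OF finD])
      moreover have "0 < (\<Sum>s\<in>D. (x s)\<^sup>2)"
        using x finD by (metis sum_power2_gt_zero_iff sum_pos2 zero_le_power2 zero_less_power2)
      ultimately show "0 < quad D (\<lambda>s t. Z h s t + \<epsilon> * E h s t) x"
        using Z0 [of x] \<epsilon> by (simp add: add_nonneg_pos)
    qed
    then show "psd_on (D \<times> J) (\<lambda>u v. kron_sum Z B u v + \<epsilon> * kron_sum E B u v)"
      unfolding kron_E .
  qed
qed

section \<open>Pencils and matricial spectrahedra\<close>

text \<open>The entries of the coefficients of a pencil, with \<open>None\<close> as the index of the constant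
  coefficient. Applied to the identity matrix and a tuple \<open>Z\<close>, it homogenises that tuple.\<close>
definition entries :: "real mat \<Rightarrow> ('n \<Rightarrow> real mat) \<Rightarrow> 'n option \<Rightarrow> nat \<Rightarrow> nat \<Rightarrow> real" where
  "entries A0 A k i j = (case k of None \<Rightarrow> A0 | Some l \<Rightarrow> A l) $$ (i, j)"

lemma sum_UNIV_option:
  "(\<Sum>k\<in>UNIV. f k) = f None + (\<Sum>i\<in>UNIV. f (Some (i :: 'n :: finite)))"
  by (simp add: UNIV_option_conv sum.reindex)

lemma symmetric_mat_iff:
  assumes "M \<in> carrier_mat n n"
  shows "symmetric_mat M \<longleftrightarrow> (\<forall>i<n. \<forall>j<n. M $$ (i, j) = M $$ (j, i))"
proof
  assume "symmetric_mat M"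
  then have T: "transpose_mat M = M" by (simp add: symmetric_mat_def)
  have "transpose_mat M $$ (i, j) = M $$ (j, i)" if "i < n" "j < n" for i j
    using assms that by (intro index_transpose_mat(1)) auto
  then show "\<forall>i<n. \<forall>j<n. M $$ (i, j) = M $$ (j, i)" unfolding T by blast
next
  assume "\<forall>i<n. \<forall>j<n. M $$ (i, j) = M $$ (j, i)"
  then show "symmetric_mat M" using assms unfolding symmetric_mat_def by (auto intro!: eq_matI)
qed

lemma scalar_prod_mult_mat_vec_eq_quad:
  assumes "M \<in> carrier_mat n n" "v \<in> carrier_vec n"
  shows "scalar_prod v (M *\<^sub>v v) = quad {..<n} (\<lambda>i j. M $$ (i, j)) (vec_index v)"
  using assms by (simp add: scalar_prod_def quad_def atLeast0LessThan sum_distrib_left mult_ac)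

lemma psd_mat_iff:
  assumes M: "M \<in> carrier_mat n n"
  shows "psd_mat M \<longleftrightarrow> psd_on {..<n} (\<lambda>i j. M $$ (i, j))"
proof -
  have "quad {..<n} (\<lambda>i j. M $$ (i, j)) x = quad {..<n} (\<lambda>i j. M $$ (i, j)) (vec_index (vec n x))" for x
    by (rule quad_cong) auto
  then have "(\<forall>v\<in>carrier_vec n. 0 \<le> quad {..<n} (\<lambda>i j. M $$ (i, j)) (vec_index v)) \<longleftrightarrow>
      (\<forall>x. 0 \<le> quad {..<n} (\<lambda>i j. M $$ (i, j)) x)"
    by (metis vec_carrier)
  moreover have "dim_row M = n" using M by simp
  ultimately show ?thesis
    unfolding psd_mat_def psd_on_def symmetric_mat_iff [OF M]
    by (auto simp: scalar_prod_mult_mat_vec_eq_quad [OF M])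
qed

lemma pd_mat_quad_pos:
  assumes M: "M \<in> carrier_mat n n" and "pd_mat M" and "\<exists>i\<in>{..<n}. x i \<noteq> 0"
  shows "0 < quad {..<n} (\<lambda>i j. M $$ (i, j)) x"
proof -
  obtain i where i: "i < n" "x i \<noteq> 0" using assms by auto
  have "vec n x \<noteq> 0\<^sub>v n"
  proof
    assume "vec n x = 0\<^sub>v n"
    then have "vec_index (vec n x) i = vec_index (0\<^sub>v n) i" by simp
    then show False using i by simp
  qed
  then have "0 < scalar_prod (vec n x) (M *\<^sub>v vec n x)"
    using assms by (auto simp: pd_mat_def)
  also have "\<dots> = quad {..<n} (\<lambda>i j. M $$ (i, j)) (vec_index (vec n x))"
    by (rule scalar_prod_mult_mat_vec_eq_quad [OF M]) simp
  also have "\<dots> = quad {..<n} (\<lambda>i j. M $$ (i, j)) x"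
    by (rule quad_cong) auto
  finally show ?thesis .
qed

text \<open>The correspondence between the row indices of a Kronecker product and pairs of row indices
  of its factors.\<close>
lemma bij_betw_pair_index:
  "bij_betw (\<lambda>(s, p). s * m + p) ({..<d} \<times> {..<m}) {..<d * m :: nat}"
proof (rule bij_betwI [where g = "\<lambda>r. (r div m, r mod m)"])
  show "(\<lambda>(s, p). s * m + p) \<in> {..<d} \<times> {..<m} \<rightarrow> {..<d * m}"
  proof clarsimp
    fix s p assume sp: "s < d" "p < m"
    then have "s * m + p < Suc s * m" by simp
    also have "\<dots> \<le> d * m" using sp by (intro mult_right_mono) auto
    finally show "s * m + p < d * m" .
  qed
  show "(\<lambda>r. (r div m, r mod m)) \<in> {..<d * m} \<rightarrow> {..<d} \<times> {..<m}"
  proof (clarsimp, intro conjI)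
    fix r assume r: "r < d * m"
    then show "r div m < d" by (rule less_mult_imp_div_less)
    show "r mod m < m" using r by (cases m) auto
  qed
qed auto

lemma sum_pair_index: "(\<Sum>r<d * m. f r) = (\<Sum>s<d. \<Sum>p<m. f (s * m + p :: nat))"
proof -
  have "(\<Sum>r<d * m. f r) = (\<Sum>u\<in>{..<d} \<times> {..<m}. f ((\<lambda>(s, p). s * m + p) u))"
    by (rule sum.reindex_bij_betw [OF bij_betw_pair_index, symmetric])
  then show ?thesis unfolding sum_Times by simp
qed

lemma pencil_coeffs_entries_sym:
  assumes "pencil_coeffs m A0 A" "p < m" "q < m"
  shows "entries A0 A k p q = entries A0 A k q p"
proof -
  define M where "M = (case k of None \<Rightarrow> A0 | Some l \<Rightarrow> A l)"
  have "M \<in> carrier_mat m m" "symmetric_mat M"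
    using assms(1) by (auto simp: M_def pencil_coeffs_def split: option.split)
  then show ?thesis
    using assms(2,3) symmetric_mat_iff [of M m] by (simp add: entries_def flip: M_def)
qed

lemma psd_mat_pencil_at_mats_iff:
  fixes A :: "'n :: finite \<Rightarrow> real mat"
  assumes A: "pencil_coeffs m A0 A" and Z: "\<And>i. Z i \<in> carrier_mat d d"
  shows "psd_mat (pencil_at_mats d A0 A Z) \<longleftrightarrow>
    psd_on ({..<d} \<times> {..<m}) (kron_sum (entries (1\<^sub>m d) Z) (entries A0 A))"
proof -
  have dims: "A0 \<in> carrier_mat m m" "\<And>i. A i \<in> carrier_mat m m" using A by (auto simp: pencil_coeffs_def)
  let ?L = "pencil_at_mats d A0 A Z"
  let ?h = "\<lambda>(s, p). s * m + p"
  have L: "?L \<in> carrier_mat (d * m) (d * m)"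
    using dims Z by (auto simp: pencil_at_mats_def sum_mats_def kronecker_prod_def)
  have range: "?h ` ({..<d} \<times> {..<m}) = {..<d * m}" and inj: "inj_on ?h ({..<d} \<times> {..<m})"
    using bij_betw_pair_index [of m d] by (auto simp: bij_betw_def)
  have "?L $$ (?h u, ?h v) = kron_sum (entries (1\<^sub>m d) Z) (entries A0 A) u v"
    if uv: "u \<in> {..<d} \<times> {..<m}" "v \<in> {..<d} \<times> {..<m}" for u v
  proof -
    have "?h u < d * m" "?h v < d * m" using uv range by blast+
    moreover obtain s p t q where "u = (s, p)" "v = (t, q)" "s < d" "p < m" "t < d" "q < m"
      using uv by auto
    ultimately show ?thesis
      using dims Z
      by (simp add: pencil_at_mats_def sum_mats_def kronecker_prod_def kron_sum_def sum_UNIV_option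
        entries_def carrier_matD [OF Z] carrier_matD [OF dims(2)])
  qed
  then show ?thesis
    unfolding psd_mat_iff [OF L] range [symmetric] psd_on_reindex [OF inj] by (rule psd_on_cong)
qed

lemma psd_mat_pencil_at_iff:
  fixes A :: "'n :: finite \<Rightarrow> real mat"
  assumes A: "pencil_coeffs m A0 A"
  shows "psd_mat (pencil_at A0 A x) \<longleftrightarrow>
    psd_on {..<m} (\<lambda>p q. \<Sum>k\<in>UNIV. (case k of None \<Rightarrow> 1 | Some i \<Rightarrow> x $ i) * entries A0 A k p q)"
proof -
  have dims: "A0 \<in> carrier_mat m m" "\<And>i. A i \<in> carrier_mat m m" using A by (auto simp: pencil_coeffs_def)
  have L: "pencil_at A0 A x \<in> carrier_mat m m"
    using dims by (auto simp: pencil_at_def sum_mats_def)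
  show ?thesis
    unfolding psd_mat_iff [OF L]
    by (rule psd_on_cong)
       (use dims in \<open>simp add: pencil_at_def sum_mats_def sum_UNIV_option entries_def carrier_matD [OF dims(2)]\<close>)
qed

lemma in_matricial_spectrahedron_iff:
  fixes A :: "'n :: finite \<Rightarrow> real mat"
  assumes A: "pencil_coeffs m A0 A" and d: "0 < d" and Z: "\<And>i. Z i \<in> carrier_mat d d"
    and sym: "\<And>i. symmetric_mat (Z i)"
  shows "Z \<in> matricial_spectrahedron A0 A \<longleftrightarrow>
    psd_on ({..<d} \<times> {..<m}) (kron_sum (entries (1\<^sub>m d) Z) (entries A0 A))"
proof -
  have "d' = d" if "\<forall>i. Z i \<in> carrier_mat d' d'" for d'
    using that Z by (metis carrier_matD(1))
  then show ?thesis
    using assms unfolding matricial_spectrahedron_def psd_mat_pencil_at_mats_iff [OF A Z, symmetric]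
    by auto
qed

text \<open>For \<open>c\<^sub>0 < 0\<close> and \<open>t \<ge> 0\<close> the matrix \<open>A\<^sub>0 + t (c\<^sub>1 A\<^sub>1 + \<dots> + c\<^sub>n A\<^sub>n)\<close> is a nonnegative
  combination of \<open>\<Sum>\<^sub>k c\<^sub>k A\<^sub>k\<close> and \<open>A\<^sub>0\<close>. So \<open>(c\<^sub>1, \<dots>, c\<^sub>n)\<close> spans a ray in the spectrahedron and
  is zero by boundedness. What remains is that \<open>c\<^sub>0 A\<^sub>0\<close> is positive semidefinite, so that
  \<open>A\<^sub>0\<close> has trace zero and vanishes.\<close>
lemma bounded_spectrahedron_homogeneous_coefficient_nonneg:
  fixes A :: "'n :: finite \<Rightarrow> real mat"
  assumes A: "pencil_coeffs m A0 A" and ne: "A0 \<noteq> 0\<^sub>m m m" and psd: "psd_mat A0"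
    and bdd: "bounded (spectrahedron A0 A)"
    and c: "psd_on {..<m} (\<lambda>p q. \<Sum>k\<in>UNIV. c k * entries A0 A k p q)"
  shows "0 \<le> c None"
proof (rule ccontr)
  assume "\<not> 0 \<le> c None"
  then have neg: "c None < 0" by simp
  have A0: "A0 \<in> carrier_mat m m" using A by (auto simp: pencil_coeffs_def)
  have psd0: "psd_on {..<m} (entries A0 A None)"
    using psd unfolding psd_mat_iff [OF A0] by (simp add: entries_def [abs_def])
  define x :: "real ^ 'n" where "x = (\<chi> i. c (Some i))"
  have ray: "t *\<^sub>R x \<in> spectrahedron A0 A" if t: "0 \<le> t" for t
  proof -
    have "0 \<le> 1 - t * c None" using t neg by (simp add: mult_nonneg_nonpos order_trans [of _ 0])
    then have "psd_on {..<m} (\<lambda>p q. t * (\<Sum>k\<in>UNIV. c k * entries A0 A k p q)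
        + (1 - t * c None) * entries A0 A None p q)"
      by (intro psd_on_add psd_on_scale c psd0 t)
    moreover have "t * (\<Sum>k\<in>UNIV. c k * entries A0 A k p q) + (1 - t * c None) * entries A0 A None p q =
      (\<Sum>k\<in>UNIV. (case k of None \<Rightarrow> 1 | Some i \<Rightarrow> (t *\<^sub>R x) $ i) * entries A0 A k p q)" for p q
      by (simp add: sum_UNIV_option x_def algebra_simps sum_distrib_left)
    ultimately show ?thesis
      by (simp add: spectrahedron_def psd_mat_pencil_at_iff [OF A])
  qed
  have "x = 0"
  proof (rule ccontr)
    assume x: "x \<noteq> 0"
    obtain r where r: "\<And>y. y \<in> spectrahedron A0 A \<Longrightarrow> norm y \<le> r"
      using bdd by (auto simp: bounded_iff)
    have "0 \<le> r" using r [OF ray [of 0]] by simp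
    then have "norm (((r + 1) / norm x) *\<^sub>R x) \<le> r" by (intro r ray) auto
    then show False using x \<open>0 \<le> r\<close> by simp
  qed
  then have "x $ i = 0" for i by simp
  then have "c (Some i) = 0" for i by (simp add: x_def)
  then have "psd_on {..<m} (\<lambda>p q. c None * entries A0 A None p q)"
    using c by (simp add: sum_UNIV_option)
  then have "c None * entries A0 A None p p \<ge> 0" if "p < m" for p
    using psd_on_diag [of "{..<m}"] that by fastforce
  then have diag: "entries A0 A None p p \<le> 0" if "p < m" for p
    using that neg by (simp add: zero_le_mult_iff not_le)
  have "entries A0 A None p q = 0" if "p < m" "q < m" for p q
  proof -
    have "\<bar>entries A0 A None p q\<bar> \<le> (\<Sum>p<m. entries A0 A None p p)"
      by (rule psd_on_entry_le_trace [OF _ psd0]) (use that in auto)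
    also have "\<dots> \<le> 0" by (rule sum_nonpos) (use diag in auto)
    finally show ?thesis by simp
  qed
  then have "A0 = 0\<^sub>m m m" using A0 by (intro eq_matI) (auto simp: entries_def)
  then show False using ne by simp
qed

section \<open>Compression identities\<close>
definition affine_monomial :: "'n option \<Rightarrow> 'n rpoly" where
  "affine_monomial k = (case k of None \<Rightarrow> 1 | Some i \<Rightarrow> poly_var i)"

lemma poly_const_mult: "poly_const (a * b) = poly_const a * poly_const b"
  by (simp add: poly_const_def mult_single)

lemma poly_const_sum: "poly_const (\<Sum>x\<in>X. f x) = (\<Sum>x\<in>X. poly_const (f x))"
  by (induction X rule: infinite_finite_induct) (simp_all add: poly_const_def single_add)

text \<open>The monomials \<open>1, X\<^sub>1, \<dots>, X\<^sub>n\<close> are linearly independent.\<close>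
lemma affine_polynomial_eq_iff:
  fixes x y :: "'n :: finite option \<Rightarrow> real"
  shows "(\<Sum>k\<in>UNIV. affine_monomial k * poly_const (x k)) =
    (\<Sum>k\<in>UNIV. affine_monomial k * poly_const (y k)) \<longleftrightarrow> (\<forall>k. x k = y k)"
proof -
  define e :: "'n option \<Rightarrow> 'n \<Rightarrow>\<^sub>0 nat"
    where "e k = (case k of None \<Rightarrow> 0 | Some i \<Rightarrow> Poly_Mapping.single i 1)" for k
  have inj: "e j = e k \<longleftrightarrow> j = k" for j k
  proof
    have single_ne: "Poly_Mapping.single i (1 :: nat) \<noteq> 0" for i :: 'n
      by (metis lookup_single_eq lookup_zero one_neq_zero)
    have "i = i'" if "Poly_Mapping.single i (1 :: nat) = Poly_Mapping.single i' 1" for i i' :: 'n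
      using that by (metis lookup_single_eq lookup_single_not_eq one_neq_zero)
    with single_ne show "e j = e k \<Longrightarrow> j = k"
      by (auto simp: e_def split: option.splits dest: sym)
  qed simp
  have "affine_monomial k * poly_const a = Poly_Mapping.single (e k) a" for k a
    by (auto simp: affine_monomial_def e_def poly_const_def poly_var_def mult_single split: option.split)
  then have "Poly_Mapping.lookup (\<Sum>k\<in>UNIV. affine_monomial k * poly_const (z k)) (e j) = z j" for z j
    by (simp add: lookup_sum lookup_single inj when_def)
  then show ?thesis by (metis (no_types, lifting) sum.cong)
qed

lemma pencil_entry:
  fixes A :: "'n :: finite \<Rightarrow> real mat"
  assumes A: "pencil_coeffs m A0 A" and pq: "p < m" "q < m"
  shows "pencil A0 A $$ (p, q) = (\<Sum>k\<in>UNIV. affine_monomial k * poly_const (entries A0 A k p q))"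
proof -
  have dims: "A0 \<in> carrier_mat m m" "\<And>i. A i \<in> carrier_mat m m" using A by (auto simp: pencil_coeffs_def)
  show ?thesis
    using dims pq
    by (simp add: pencil_def sum_mats_def sum_UNIV_option entries_def affine_monomial_def
      carrier_matD [OF dims(2)])
qed

text \<open>Both sides are affine in the variables, so the polynomial identity can be compared
  coefficientwise. Row \<open>\<kappa> * m + p\<close> of \<open>V\<close> is row \<open>p\<close> of its block \<open>\<kappa>\<close>.\<close>
lemma pencil_eq_compression_iff:
  fixes A B :: "'n :: finite \<Rightarrow> real mat"
  assumes A: "pencil_coeffs m A0 A" and B: "pencil_coeffs n B0 B"
    and V: "V \<in> carrier_mat (\<mu> * m) n"
  shows "pencil B0 B = transpose_mat (const_mat V) * (1\<^sub>m \<mu> \<otimes>\<^sub>k pencil A0 A) * const_mat V \<longleftrightarrow>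
    (\<forall>k. \<forall>a<n. \<forall>b<n. entries B0 B k a b =
      (\<Sum>\<kappa><\<mu>. \<Sum>p<m. \<Sum>q<m. V $$ (\<kappa> * m + p, a) * V $$ (\<kappa> * m + q, b) * entries A0 A k p q))"
proof -
  let ?W = "const_mat V :: 'n rpoly mat"
  let ?K = "1\<^sub>m \<mu> \<otimes>\<^sub>k pencil A0 A"
  let ?R = "transpose_mat ?W * ?K * ?W"
  let ?c = "\<lambda>k a b. \<Sum>\<kappa><\<mu>. \<Sum>p<m. \<Sum>q<m. V $$ (\<kappa> * m + p, a) * V $$ (\<kappa> * m + q, b) * entries A0 A k p q"
  have dims: "A0 \<in> carrier_mat m m" "B0 \<in> carrier_mat n n"
    using A B by (auto simp: pencil_coeffs_def)
  have LA: "pencil A0 A \<in> carrier_mat m m" and LB: "pencil B0 B \<in> carrier_mat n n"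
    using dims by (auto simp: pencil_def sum_mats_def)
  have K: "?K \<in> carrier_mat (\<mu> * m) (\<mu> * m)" using LA by (auto simp: kronecker_prod_def)
  have R: "?R \<in> carrier_mat n n" using K V by auto
  have bound: "\<kappa> * m + p < \<mu> * m" if "\<kappa> < \<mu>" "p < m" for \<kappa> p
    using bij_betw_apply [OF bij_betw_pair_index [of m \<mu>], of "(\<kappa>, p)"] that by simp
  have Kentry: "?K $$ (\<kappa> * m + p, \<kappa>' * m + q) = (if \<kappa> = \<kappa>' then pencil A0 A $$ (p, q) else 0)"
    if "\<kappa> < \<mu>" "p < m" "\<kappa>' < \<mu>" "q < m" for \<kappa> p \<kappa>' q
    using that LA bound by (simp add: kronecker_prod_def)
  have entry: "?R $$ (a, b) = (\<Sum>k\<in>UNIV. affine_monomial k * poly_const (?c k a b))"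
    if ab: "a < n" "b < n" for a b
  proof -
    have "?R $$ (a, b) = (\<Sum>s<\<mu> * m. (\<Sum>r<\<mu> * m. ?W $$ (r, a) * ?K $$ (r, s)) * ?W $$ (s, b))"
    proof -
      have "?R $$ (a, b) = scalar_prod (row (transpose_mat ?W * ?K) a) (col ?W b)"
        by (rule index_mult_mat(1)) (use ab V in auto)
      also have "\<dots> = (\<Sum>s<\<mu> * m. (transpose_mat ?W * ?K) $$ (a, s) * ?W $$ (s, b))"
        using ab V K by (auto simp: scalar_prod_def atLeast0LessThan intro!: sum.cong)
      also have "\<dots> = (\<Sum>s<\<mu> * m. (\<Sum>r<\<mu> * m. ?W $$ (r, a) * ?K $$ (r, s)) * ?W $$ (s, b))"
        using ab V K by (auto simp: scalar_prod_def atLeast0LessThan intro!: sum.cong)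
      finally show ?thesis .
    qed
    also have "\<dots> = (\<Sum>s<\<mu> * m. \<Sum>r<\<mu> * m. ?W $$ (r, a) * ?K $$ (r, s) * ?W $$ (s, b))"
      by (simp add: sum_distrib_right)
    also have "\<dots> = (\<Sum>r<\<mu> * m. \<Sum>s<\<mu> * m. ?W $$ (r, a) * ?K $$ (r, s) * ?W $$ (s, b))"
      by (rule sum.swap)
    also have "\<dots> = (\<Sum>\<kappa><\<mu>. \<Sum>p<m. \<Sum>\<kappa>'<\<mu>. if \<kappa> = \<kappa>' then
        (\<Sum>q<m. poly_const (V $$ (\<kappa> * m + p, a)) * pencil A0 A $$ (p, q) * poly_const (V $$ (\<kappa> * m + q, b))) else 0)"
      unfolding sum_pair_index using V ab bound
      by (intro sum.cong refl) (auto simp: Kentry intro!: sum.cong sum.neutral)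
    also have "\<dots> = (\<Sum>\<kappa><\<mu>. \<Sum>p<m. \<Sum>q<m.
        poly_const (V $$ (\<kappa> * m + p, a)) * pencil A0 A $$ (p, q) * poly_const (V $$ (\<kappa> * m + q, b)))"
      by (rule sum.cong [OF refl], rule sum.cong [OF refl]) simp
    also have "\<dots> = (\<Sum>\<kappa><\<mu>. \<Sum>p<m. \<Sum>q<m. \<Sum>k\<in>UNIV. affine_monomial k *
        poly_const (V $$ (\<kappa> * m + p, a) * V $$ (\<kappa> * m + q, b) * entries A0 A k p q))"
      by (intro sum.cong refl)
         (simp add: pencil_entry [OF A] sum_distrib_left sum_distrib_right poly_const_mult mult_ac)
    also have "\<dots> = (\<Sum>\<kappa><\<mu>. \<Sum>k\<in>UNIV. \<Sum>p<m. \<Sum>q<m. affine_monomial k *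
        poly_const (V $$ (\<kappa> * m + p, a) * V $$ (\<kappa> * m + q, b) * entries A0 A k p q))"
      by (rule sum.cong [OF refl], rule sum_rotate3 [symmetric])
    also have "\<dots> = (\<Sum>k\<in>UNIV. affine_monomial k * poly_const (?c k a b))"
      by (subst sum.swap) (simp add: poly_const_sum sum_distrib_left)
    finally show ?thesis .
  qed
  have "pencil B0 B = ?R" if "\<forall>a<n. \<forall>b<n. pencil B0 B $$ (a, b) = ?R $$ (a, b)"
    using that by (intro eq_matI) (simp_all only: carrier_matD [OF LB] carrier_matD [OF R])
  then have "pencil B0 B = ?R \<longleftrightarrow> (\<forall>a<n. \<forall>b<n. pencil B0 B $$ (a, b) = ?R $$ (a, b))"
    by metis
  also have "\<dots> \<longleftrightarrow> (\<forall>a<n. \<forall>b<n. \<forall>k. entries B0 B k a b = ?c k a b)"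
    by (simp only: entry pencil_entry [OF B] affine_polynomial_eq_iff cong: imp_cong)
  finally show ?thesis by blast
qed

text \<open>Each block of \<open>V\<close> acts on \<open>L\<^sub>1(Z)\<close> by a congruence, and \<open>L\<^sub>2(Z)\<close> is the sum of the
  results.\<close>
lemma matricial_spectrahedron_subset_if_compression:
  fixes A B :: "'n :: finite \<Rightarrow> real mat" and \<mu> :: nat
  assumes A: "pencil_coeffs m A0 A" and B: "pencil_coeffs n B0 B"
    and compr: "\<And>k a b. a < n \<Longrightarrow> b < n \<Longrightarrow> entries B0 B k a b =
      (\<Sum>\<kappa><\<mu>. \<Sum>p<m. \<Sum>q<m. V \<kappa> a p * V \<kappa> b q * entries A0 A k p q)"
  shows "matricial_spectrahedron A0 A \<subseteq> matricial_spectrahedron B0 B"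
proof
  fix Z assume "Z \<in> matricial_spectrahedron A0 A"
  then obtain d where d: "0 < d" and Z: "\<And>i. Z i \<in> carrier_mat d d" and sym: "\<And>i. symmetric_mat (Z i)"
    by (auto simp: matricial_spectrahedron_def)
  let ?Z = "entries (1\<^sub>m d) Z"
  let ?B = "\<lambda>\<kappa> k a b. \<Sum>p<m. \<Sum>q<m. V \<kappa> a p * V \<kappa> b q * entries A0 A k p q"
  have psd: "psd_on ({..<d} \<times> {..<m}) (kron_sum ?Z (entries A0 A))"
    using \<open>Z \<in> matricial_spectrahedron A0 A\<close> in_matricial_spectrahedron_iff [OF A d Z sym] by simp
  have "psd_on ({..<d} \<times> {..<n}) (\<lambda>u v. \<Sum>\<kappa><N. kron_sum ?Z (?B \<kappa>) u v)" for N :: nat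
    by (induction N) (auto intro!: psd_on_zero psd_on_add psd_on_kron_congruence_right psd)
  moreover have "kron_sum ?Z (entries B0 B) u v = (\<Sum>\<kappa><\<mu>. kron_sum ?Z (?B \<kappa>) u v)"
    if uv: "u \<in> {..<d} \<times> {..<n}" "v \<in> {..<d} \<times> {..<n}" for u v
  proof -
    have "snd u < n" "snd v < n" using uv by auto
    then have "kron_sum ?Z (entries B0 B) u v =
      (\<Sum>k\<in>UNIV. \<Sum>\<kappa><\<mu>. ?Z k (fst u) (fst v) * ?B \<kappa> k (snd u) (snd v))"
      by (simp add: kron_sum_def compr sum_distrib_left)
    also have "\<dots> = (\<Sum>\<kappa><\<mu>. kron_sum ?Z (?B \<kappa>) u v)"
      unfolding kron_sum_def by (rule sum.swap)
    finally show ?thesis .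
  qed
  ultimately have "psd_on ({..<d} \<times> {..<n}) (kron_sum ?Z (entries B0 B))"
    by (metis (no_types, lifting) psd_on_cong)
  then show "Z \<in> matricial_spectrahedron B0 B"
    using in_matricial_spectrahedron_iff [OF B d Z sym] by simp
qed

text \<open>The inclusion is applied to tuples of the size of \<open>L\<^sub>2\<close>. The columns of a Gram factor of
  the Choi matrix, reshaped to matrices, are the blocks of \<open>V\<close>.\<close>
lemma compression_if_matricial_spectrahedron_subset:
  fixes A B :: "'n :: finite \<Rightarrow> real mat"
  assumes A: "pencil_coeffs m A0 A" and B: "pencil_coeffs n B0 B"
    and ne: "A0 \<noteq> 0\<^sub>m m m" and psd: "psd_mat A0" and bdd: "bounded (spectrahedron A0 A)"
    and pd: "\<exists>P\<in>pencil_span A0 A. pd_mat P"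
    and sub: "matricial_spectrahedron A0 A \<subseteq> matricial_spectrahedron B0 B"
  shows "\<exists>\<mu>>(0 :: nat). \<exists>V. \<forall>k. \<forall>a<n. \<forall>b<n. entries B0 B k a b =
      (\<Sum>\<kappa><\<mu>. \<Sum>p<m. \<Sum>q<m. V \<kappa> a p * V \<kappa> b q * entries A0 A k p q)"
proof (cases "n = 0")
  case True
  then show ?thesis by (auto intro!: exI [of _ "1 :: nat"])
next
  case False
  then have n: "0 < n" by simp
  let ?I = "{..<m}" and ?J = "{..<n}"
  let ?A = "entries A0 A" and ?B = "entries B0 B"
  have A0: "A0 \<in> carrier_mat m m" and dimA: "\<And>i. A i \<in> carrier_mat m m"
    using A by (auto simp: pencil_coeffs_def)
  have "m \<noteq> 0"
  proof
    assume "m = 0"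
    then have "A0 = 0\<^sub>m m m" using A0 by (intro eq_matI) auto
    then show False using ne by simp
  qed
  obtain c0 c where P: "pd_mat (c0 \<cdot>\<^sub>m A0 + sum_mats (dim_row A0) (\<lambda>i. c i \<cdot>\<^sub>m A i))"
    using pd by (auto simp: pencil_span_def)
  define c' where "c' k = (case k of None \<Rightarrow> c0 | Some i \<Rightarrow> c i)" for k
  have pos: "0 < quad ?I (\<lambda>p q. \<Sum>k\<in>UNIV. c' k * ?A k p q) x" if x: "\<exists>p\<in>?I. x p \<noteq> 0" for x
  proof -
    let ?P = "c0 \<cdot>\<^sub>m A0 + sum_mats (dim_row A0) (\<lambda>i. c i \<cdot>\<^sub>m A i)"
    have "0 < quad ?I (\<lambda>p q. ?P $$ (p, q)) x"
      by (rule pd_mat_quad_pos [OF _ P x]) (use A0 in \<open>auto simp: sum_mats_def\<close>)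
    also have "\<dots> = quad ?I (\<lambda>p q. \<Sum>k\<in>UNIV. c' k * ?A k p q) x"
      by (rule quad_cong)
         (use A0 in \<open>simp_all add: sum_mats_def sum_UNIV_option c'_def entries_def carrier_matD [OF dimA]\<close>)
    finally show ?thesis .
  qed
  have symA: "?A k p q = ?A k q p" if "p \<in> ?I" "q \<in> ?I" for k p q
    using pencil_coeffs_entries_sym [OF A] that by auto
  have symB: "?B k p q = ?B k q p" if "p \<in> ?J" "q \<in> ?J" for k p q
    using pencil_coeffs_entries_sym [OF B] that by auto
  have psd0: "psd_on ?I (?A None)"
    using psd unfolding psd_mat_iff [OF A0] by (simp add: entries_def [abs_def])
  have incl: "psd_on (?J \<times> ?J) (kron_sum Z ?B)"
    if symZ: "\<And>k s t. s \<in> ?J \<Longrightarrow> t \<in> ?J \<Longrightarrow> Z k s t = Z k t s"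
      and unit: "\<And>s t. s \<in> ?J \<Longrightarrow> t \<in> ?J \<Longrightarrow> Z None s t = (if s = t then 1 else 0)"
      and psdZ: "psd_on (?J \<times> ?I) (kron_sum Z ?A)" for Z
  proof -
    define Y where "Y i = mat n n (\<lambda>(s, t). Z (Some i) s t)" for i
    have Y: "Y i \<in> carrier_mat n n" for i by (simp add: Y_def)
    have symY: "symmetric_mat (Y i)" for i
      unfolding symmetric_mat_iff [OF Y] using symZ by (simp add: Y_def)
    have "entries (1\<^sub>m n) Y k s t = Z k s t" if "s < n" "t < n" for k s t
      using that unit by (auto simp: entries_def Y_def split: option.split)
    then have "kron_sum (entries (1\<^sub>m n) Y) M u v = kron_sum Z M u v"
      if "u \<in> ?J \<times> X" "v \<in> ?J \<times> X" for u v X and M :: "'n option \<Rightarrow> nat \<Rightarrow> nat \<Rightarrow> real"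
      using that by (auto simp: kron_sum_def)
    then have eq: "psd_on (?J \<times> X) (kron_sum (entries (1\<^sub>m n) Y) M) \<longleftrightarrow> psd_on (?J \<times> X) (kron_sum Z M)"
      for X and M :: "'n option \<Rightarrow> nat \<Rightarrow> nat \<Rightarrow> real"
      by (rule psd_on_cong)
    have "Y \<in> matricial_spectrahedron A0 A"
      using psdZ in_matricial_spectrahedron_iff [OF A n Y symY] by (simp add: eq)
    then have "Y \<in> matricial_spectrahedron B0 B" using sub by blast
    then show ?thesis
      using in_matricial_spectrahedron_iff [OF B n Y symY] by (simp add: eq)
  qed
  have cp: "psd_on (?J \<times> ?J) (kron_sum D ?B)"
    if symD: "\<And>k a b. a \<in> ?J \<Longrightarrow> b \<in> ?J \<Longrightarrow> D k a b = D k b a"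
      and psdD: "psd_on (?J \<times> ?I) (kron_sum D ?A)" for D
  proof (rule completely_positive_if_monic_inclusion [where h = None and I = ?I and A = ?A])
    show "0 \<le> e None" if "psd_on ?I (\<lambda>p q. \<Sum>k\<in>UNIV. e k * ?A k p q)" for e
      using that by (rule bounded_spectrahedron_homogeneous_coefficient_nonneg [OF A ne psd bdd])
    show "psd_on (?J \<times> ?J) (kron_sum Z ?B)"
      if "\<And>k s t. s \<in> ?J \<Longrightarrow> t \<in> ?J \<Longrightarrow> Z k s t = Z k t s"
        and "\<And>s t. s \<in> ?J \<Longrightarrow> t \<in> ?J \<Longrightarrow> Z None s t = (if s = t then 1 else 0)"
        and "psd_on (?J \<times> ?I) (kron_sum Z ?A)" for Z
      using that by (rule incl)
  qed (use symB psd0 symD psdD in auto)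
  have "\<exists>C. psd_on (?J \<times> ?I) C \<and> (\<forall>k. \<forall>a\<in>?J. \<forall>b\<in>?J. ?B k a b = choi_map ?I C (?A k) a b)"
  proof (rule completely_positive_choi_matrix [where c = c'])
    show "psd_on (?J \<times> ?J) (kron_sum D ?B)"
      if "\<And>k a b. a \<in> ?J \<Longrightarrow> b \<in> ?J \<Longrightarrow> D k a b = D k b a"
        and "psd_on (?J \<times> ?I) (kron_sum D ?A)" for D
      using that by (rule cp)
  qed (use symA symB pos in auto)
  then obtain C where C: "psd_on (?J \<times> ?I) C"
      "\<And>k a b. a \<in> ?J \<Longrightarrow> b \<in> ?J \<Longrightarrow> ?B k a b = choi_map ?I C (?A k) a b"
    by blast
  obtain F where F: "\<And>u v. u \<in> ?J \<times> ?I \<Longrightarrow> v \<in> ?J \<times> ?I \<Longrightarrow> C u v = (\<Sum>s\<in>?J \<times> ?I. F u s * F v s)"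
    using psd_on_gram [OF _ C(1)] by blast
  define \<mu> where "\<mu> = card (?J \<times> ?I)"
  obtain h where h: "bij_betw h {..<\<mu>} (?J \<times> ?I)"
    using ex_bij_betw_nat_finite [of "?J \<times> ?I"] by (auto simp: \<mu>_def atLeast0LessThan)
  have "?B k a b = (\<Sum>\<kappa><\<mu>. \<Sum>p<m. \<Sum>q<m. F (a, p) (h \<kappa>) * F (b, q) (h \<kappa>) * ?A k p q)"
    if ab: "a < n" "b < n" for k a b
  proof -
    have "?B k a b = (\<Sum>p<m. \<Sum>q<m. (\<Sum>s\<in>?J \<times> ?I. F (a, p) s * F (b, q) s) * ?A k p q)"
      using ab by (simp add: C(2) choi_map_def F)
    also have "\<dots> = (\<Sum>p<m. \<Sum>q<m. \<Sum>\<kappa><\<mu>. F (a, p) (h \<kappa>) * F (b, q) (h \<kappa>) * ?A k p q)"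
      by (simp add: sum_distrib_right flip: sum.reindex_bij_betw [OF h])
    also have "\<dots> = (\<Sum>\<kappa><\<mu>. \<Sum>p<m. \<Sum>q<m. F (a, p) (h \<kappa>) * F (b, q) (h \<kappa>) * ?A k p q)"
      by (rule sum_rotate3 [symmetric])
    finally show ?thesis .
  qed
  moreover have "0 < \<mu>" using n \<open>m \<noteq> 0\<close> by (simp add: \<mu>_def)
  ultimately show ?thesis by (intro exI [of _ \<mu>] conjI exI [of _ "\<lambda>\<kappa> a p. F (a, p) (h \<kappa>)"]) auto
qed

theorem corollary4p2p3:
  fixes A10 A20 :: "real mat"
    and A1 A2 :: "'n :: finite \<Rightarrow> real mat"
    and m1 m2 :: nat
  assumes "pencil_coeffs m1 A10 A1"
    and "pencil_coeffs m2 A20 A2"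
    and "A10 \<noteq> 0\<^sub>m m1 m1"
    and "psd_mat A10"
    and "bounded (spectrahedron A10 A1)"
    and "\<exists>P \<in> pencil_span A10 A1. pd_mat P"
  shows "matricial_spectrahedron A10 A1 \<subseteq> matricial_spectrahedron A20 A2 \<longleftrightarrow>
    (\<exists>\<mu> > 0. \<exists>V \<in> carrier_mat (\<mu> * m1) m2.
       pencil A20 A2 =
         transpose_mat (const_mat V) * (1\<^sub>m \<mu> \<otimes>\<^sub>k pencil A10 A1) * const_mat V)"
proof
  assume "matricial_spectrahedron A10 A1 \<subseteq> matricial_spectrahedron A20 A2"
  from compression_if_matricial_spectrahedron_subset [OF assms this]
  obtain \<mu> :: nat and V where \<mu>: "0 < \<mu>" and V: "\<And>k a b. a < m2 \<Longrightarrow> b < m2 \<Longrightarrow> entries A20 A2 k a b =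
      (\<Sum>\<kappa><\<mu>. \<Sum>p<m1. \<Sum>q<m1. V \<kappa> a p * V \<kappa> b q * entries A10 A1 k p q)"
    by blast
  define W where "W = mat (\<mu> * m1) m2 (\<lambda>(r, a). V (r div m1) a (r mod m1))"
  have W: "W \<in> carrier_mat (\<mu> * m1) m2" by (simp add: W_def)
  have "W $$ (\<kappa> * m1 + p, a) = V \<kappa> a p" if "\<kappa> < \<mu>" "p < m1" "a < m2" for \<kappa> p a
    using bij_betw_apply [OF bij_betw_pair_index [of m1 \<mu>], of "(\<kappa>, p)"] that by (simp add: W_def)
  then have "pencil A20 A2 = transpose_mat (const_mat W) * (1\<^sub>m \<mu> \<otimes>\<^sub>k pencil A10 A1) * const_mat W"
    unfolding pencil_eq_compression_iff [OF assms(1,2) W] by (simp add: V)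
  then show "\<exists>\<mu> > 0. \<exists>V \<in> carrier_mat (\<mu> * m1) m2. pencil A20 A2 =
      transpose_mat (const_mat V) * (1\<^sub>m \<mu> \<otimes>\<^sub>k pencil A10 A1) * const_mat V"
    using \<mu> W by blast
next
  assume "\<exists>\<mu> > 0. \<exists>V \<in> carrier_mat (\<mu> * m1) m2. pencil A20 A2 =
      transpose_mat (const_mat V) * (1\<^sub>m \<mu> \<otimes>\<^sub>k pencil A10 A1) * const_mat V"
  then obtain \<mu> V where "V \<in> carrier_mat (\<mu> * m1) m2" "pencil A20 A2 =
      transpose_mat (const_mat V) * (1\<^sub>m \<mu> \<otimes>\<^sub>k pencil A10 A1) * const_mat V"
    by blast
  then show "matricial_spectrahedron A10 A1 \<subseteq> matricial_spectrahedron A20 A2"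
    using pencil_eq_compression_iff [OF assms(1,2), of V \<mu>]
    by (intro matricial_spectrahedron_subset_if_compression [OF assms(1,2),
          where V = "\<lambda>\<kappa> a p. V $$ (\<kappa> * m1 + p, a)" and \<mu> = \<mu>]) blast
qed

end
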